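(* Let $q>1$ and let $\Omega\subset\mathbb{R}^N$ be a bounded domain whose boundary $\Gamma=\partial\Omega$ is locally a continuous graph. Then for every $f\in L^1_{loc}(\Omega)$ with $f\ge0$, there exists at most one positive solution $u$ of $$\partial_t u-\Delta u+|u|^{q-1}u=0\quad\text{in }\Omega\times(0,\infty)$$ satisfying $$\lim_{t\to0}u(\cdot,t)=f\quad\text{in }L^1_{loc}(\Omega)$$ and $$\lim_{(x,t)\to(y,s)}u(x,t)=\infty\quad\text{for all }(y,s)\in\Gamma\times(0,\infty).$$
   Context: "$\partial\Omega$ is locally a continuous graph" means: there is a finite number of open sets $\Omega_1,\dots,\Omega_k\subset\mathbb{R}^N$ covering $\Gamma$ such that, for each $j$, after a suitable rotation of the coordinates, $\Gamma\cap\Omega_j$ is the graph $x_N=\phi(x')$ of a continuous function $\phi$ of $x'\in\mathbb{R}^{N-1}$ (where $x=(x',x_N)$). Solutions are understood in the classical sense ($C^2$ in $x$, $C^1$ in $t$) in $\Omega\times(0,\infty)$. Convergence in $L^1_{loc}(\Omega)$ means convergence in $L^1(K)$ for every compact $K\subset\Omega$. In the boundary limit, $(x,t)$ ranges over $\Omega\times(0,\infty)$. *)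

theory Defs
  imports "HOL-Analysis.Analysis"
begin

text \<open>
  The hyperplane \<open>{z. z $ k = 0}\<close> plays the role of \<open>\<real>\<^sup>N\<^sup>-\<^sup>1\<close>, so that
  \<open>z + \<phi> z *\<^sub>R axis k 1\<close> is the point \<open>(x', \<phi>(x'))\<close>; this makes sense for \<open>N = 1\<close> as well.
  The function \<open>\<phi>\<close> is defined on a relatively open set \<open>D\<close>: a graph over the whole hyperplane is
  unbounded for \<open>N \<ge> 2\<close>, and arbitrary \<open>D\<close> would admit isolated boundary points and slits.
  The index \<open>k\<close> names the distinguished coordinate, as a finite index type has no last element.
\<close>

definition locally_continuous_graph :: "(real ^ 'n) set \<Rightarrow> bool" where
  "locally_continuous_graph \<Gamma> \<longleftrightarrow>
     (\<exists>\<W>. finite \<W> \<and> (\<forall>W\<in>\<W>. open W) \<and> \<Gamma> \<subseteq> \<Union>\<W> \<and>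
       (\<forall>W\<in>\<W>. \<exists>(Q :: real ^ 'n ^ 'n) k D \<phi>.
          rotation_matrix Q \<and>
          openin (top_of_set {z. z $ k = 0}) D \<and> continuous_on D \<phi> \<and>
          (\<lambda>x. Q *v x) ` (\<Gamma> \<inter> W) = (\<lambda>z. z + \<phi> z *\<^sub>R axis k 1) ` D))"

definition partial_deriv :: "'n \<Rightarrow> (real ^ 'n \<Rightarrow> real) \<Rightarrow> real ^ 'n \<Rightarrow> real" where
  "partial_deriv i w x = deriv (\<lambda>h. w (x + h *\<^sub>R axis i 1)) 0"

definition has_partial_deriv_at :: "'n \<Rightarrow> (real ^ 'n \<Rightarrow> real) \<Rightarrow> real ^ 'n \<Rightarrow> bool" where
  "has_partial_deriv_at i w x \<longleftrightarrow> (\<lambda>h. w (x + h *\<^sub>R axis i 1)) differentiable (at 0)"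

definition laplacian :: "(real ^ 'n \<Rightarrow> real) \<Rightarrow> real ^ 'n \<Rightarrow> real" where
  "laplacian w x = (\<Sum>i\<in>UNIV. partial_deriv i (partial_deriv i w) x)"

text \<open>
  The class \<open>C\<^sup>2\<^sup>,\<^sup>1(\<Omega> \<times> (0,\<infinity>))\<close>: the function, its time derivative and its spatial partial
  derivatives up to order two exist and are jointly continuous. Only values on \<open>\<Omega> \<times> (0,\<infinity>)\<close> matter,
  provided \<open>\<Omega>\<close> is open.
\<close>

definition C21_on :: "(real ^ 'n) set \<Rightarrow> (real ^ 'n \<Rightarrow> real \<Rightarrow> real) \<Rightarrow> bool" where
  "C21_on \<Omega> u \<longleftrightarrow>
     continuous_on (\<Omega> \<times> {0<..}) (\<lambda>(x, t). u x t) \<and>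
     (\<forall>x\<in>\<Omega>. \<forall>t>0. u x differentiable (at t)) \<and>
     continuous_on (\<Omega> \<times> {0<..}) (\<lambda>(x, t). deriv (u x) t) \<and>
     (\<forall>i. (\<forall>x\<in>\<Omega>. \<forall>t>0. has_partial_deriv_at i (\<lambda>y. u y t) x) \<and>
          continuous_on (\<Omega> \<times> {0<..}) (\<lambda>(x, t). partial_deriv i (\<lambda>y. u y t) x)) \<and>
     (\<forall>i j. (\<forall>x\<in>\<Omega>. \<forall>t>0. has_partial_deriv_at j (partial_deriv i (\<lambda>y. u y t)) x) \<and>
          continuous_on (\<Omega> \<times> {0<..})
            (\<lambda>(x, t). partial_deriv j (partial_deriv i (\<lambda>y. u y t)) x))"

definition classical_solution ::
    "real \<Rightarrow> (real ^ 'n) set \<Rightarrow> (real ^ 'n \<Rightarrow> real \<Rightarrow> real) \<Rightarrow> bool" where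
  "classical_solution q \<Omega> u \<longleftrightarrow>
     C21_on \<Omega> u \<and>
     (\<forall>x\<in>\<Omega>. \<forall>t>0.
        deriv (u x) t - laplacian (\<lambda>y. u y t) x + \<bar>u x t\<bar> powr (q - 1) * u x t = 0)"

definition L1_loc :: "(real ^ 'n) set \<Rightarrow> (real ^ 'n \<Rightarrow> real) \<Rightarrow> bool" where
  "L1_loc \<Omega> f \<longleftrightarrow> (\<forall>K. compact K \<and> K \<subseteq> \<Omega> \<longrightarrow> f absolutely_integrable_on K)"

text \<open>
  Membership of \<open>w s - f\<close> in \<open>L\<^sup>1(K)\<close> is required because the Bochner integral of a non-integrable
  function is \<open>0\<close> by convention.
\<close>

definition tendsto_L1_loc ::
    "(real ^ 'n) set \<Rightarrow> ('b \<Rightarrow> real ^ 'n \<Rightarrow> real) \<Rightarrow> (real ^ 'n \<Rightarrow> real) \<Rightarrow> 'b filter \<Rightarrow> bool" where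
  "tendsto_L1_loc \<Omega> w f F \<longleftrightarrow>
     (\<forall>K. compact K \<and> K \<subseteq> \<Omega> \<longrightarrow>
        (\<forall>\<^sub>F s in F. (\<lambda>x. w s x - f x) absolutely_integrable_on K) \<and>
        ((\<lambda>s. LINT x:K|lebesgue. \<bar>w s x - f x\<bar>) \<longlongrightarrow> 0) F)"

definition positive_large_solution ::
    "real \<Rightarrow> (real ^ 'n) set \<Rightarrow> (real ^ 'n \<Rightarrow> real) \<Rightarrow> (real ^ 'n \<Rightarrow> real \<Rightarrow> real) \<Rightarrow> bool" where
  "positive_large_solution q \<Omega> f u \<longleftrightarrow>
     classical_solution q \<Omega> u \<and>
     (\<forall>x\<in>\<Omega>. \<forall>t>0. u x t > 0) \<and>
     tendsto_L1_loc \<Omega> (\<lambda>t x. u x t) f (at_right 0) \<and>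
     (\<forall>y\<in>frontier \<Omega>. \<forall>s>0.
        filterlim (\<lambda>(x, t). u x t) at_top (at (y, s) within \<Omega> \<times> {0<..}))"

end

theory Submission
  imports Defs
begin

text \<open>
  Let \<open>z = v - u\<close>. By convexity of \<open>r \<mapsto> r\<^sup>q\<close>, \<open>z\<^sup>+\<close> is a subsolution of the same equation with
  zero initial trace. Near a boundary point \<open>y\<close> let \<open>B\<close> be an explicit supersolution in a ball around
  \<open>y\<close> that blows up on the sphere and vanishes at \<open>t = 0\<close>. Then \<open>n (z - B) \<le> u\<close> near \<open>y\<close> for all
  \<open>n\<close>, by induction: \<open>(n - 1) (z - B) \<le> u\<close> and convexity make \<open>n (z - B)\<close> a subsolution where it is
  positive; pushed a little into \<open>\<Omega>\<close> along the vertical direction of the graph, it is bounded on the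
  part of \<open>\<Gamma>\<close> where \<open>u = \<infinity>\<close>, and it vanishes initially, so it is dominated by \<open>u\<close>. Letting
  \<open>n \<rightarrow> \<infinity>\<close> gives \<open>z \<le> B\<close>. Hence \<open>z\<close> is bounded up to \<open>\<Gamma>\<close> and tends to \<open>0\<close> there as \<open>t \<rightarrow> 0\<close>, and
  \<open>v - (1 + \<epsilon>) u = z - \<epsilon> u\<close> has nonpositive parabolic boundary values; the maximum principle yields
  \<open>v \<le> (1 + \<epsilon>) u\<close>.
\<close>

text \<open>Both solutions are infinite on \<Gamma>, and for a boundary that is only a continuous
  graph nothing is known about the rate of blow-up, so \<open>v - u\<close> has no usable boundary
  values. Pushing \<open>v\<close> itself into \<Omega> would make it finite where \<open>u\<close>
  is infinite, but would also shift the trace \<open>f\<close>, which need not be comparable with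
  its translate. The difference has trace zero, so its translates are harmless at
  \<open>t = 0\<close>; this is why the translation argument is run on the difference. One
  comparison only gives \<open>v - u - B \<le> u\<close>, whereas multiples give
  \<open>v - u - B \<le> u / n\<close>. For q > 1, however, a multiple of a subsolution is in
  general not a subsolution: its absorption grows like \<open>n powr q\<close>, its source only like
  \<open>n\<close>. The bound obtained for \<open>n - 1\<close> makes the difference small compared
  with \<open>u\<close>, and in that range convexity of the power supplies the missing factor. The
  barrier keeps the argument local, as the graph representation is.\<close>

section \<open>Calculus of the heat operator\<close>

definition heat_parts ::
    "(real ^ 'n) set \<Rightarrow> (real ^ 'n \<Rightarrow> real \<Rightarrow> real) \<Rightarrow> (real ^ 'n \<Rightarrow> real \<Rightarrow> real) \<Rightarrow>
     ('n \<Rightarrow> real ^ 'n \<Rightarrow> real \<Rightarrow> real) \<Rightarrow> ('n \<Rightarrow> real ^ 'n \<Rightarrow> real \<Rightarrow> real) \<Rightarrow> bool" where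
  "heat_parts P w wt w1 w2 \<longleftrightarrow>
     continuous_on (P \<times> {0<..}) (\<lambda>p. w (fst p) (snd p)) \<and>
     continuous_on (P \<times> {0<..}) (\<lambda>p. wt (fst p) (snd p)) \<and>
     (\<forall>i. continuous_on (P \<times> {0<..}) (\<lambda>p. w1 i (fst p) (snd p))) \<and>
     (\<forall>i. continuous_on (P \<times> {0<..}) (\<lambda>p. w2 i (fst p) (snd p))) \<and>
     (\<forall>x\<in>P. \<forall>t>0. (w x has_real_derivative wt x t) (at t)) \<and>
     (\<forall>x\<in>P. \<forall>t>0. \<forall>i. ((\<lambda>h. w (x + h *\<^sub>R axis i 1) t) has_real_derivative w1 i x t) (at 0)) \<and>
     (\<forall>x\<in>P. \<forall>t>0. \<forall>i. ((\<lambda>h. w1 i (x + h *\<^sub>R axis i 1) t) has_real_derivative w2 i x t) (at 0))"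

text \<open>
  \<open>heat_on P w L\<close> expresses \<open>\<partial>\<^sub>t w - \<Delta> w = L\<close> on \<open>P \<times> (0,\<infinity>)\<close>. Mixed derivatives never enter, so all
  differentiations are one-dimensional.
\<close>

definition heat_on ::
    "(real ^ 'n) set \<Rightarrow> (real ^ 'n \<Rightarrow> real \<Rightarrow> real) \<Rightarrow> (real ^ 'n \<Rightarrow> real \<Rightarrow> real) \<Rightarrow> bool" where
  "heat_on P w L \<longleftrightarrow>
     (\<exists>wt w1 w2. heat_parts P w wt w1 w2 \<and>
        (\<forall>x\<in>P. \<forall>t>0. L x t = wt x t - (\<Sum>i\<in>UNIV. w2 i x t)))"

text \<open>The definition differentiates at \<open>h = 0\<close> only; moving the base point along
  the axis yields derivatives on a whole interval, as the mean value theorem and differentiation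
  under the integral require.\<close>

lemma heat_parts_deriv_along:
  assumes "heat_parts P w wt w1 w2" "x + h *\<^sub>R axis i 1 \<in> P" "t > 0"
  shows "((\<lambda>h. w (x + h *\<^sub>R axis i 1) t) has_real_derivative w1 i (x + h *\<^sub>R axis i 1) t) (at h)"
    and "((\<lambda>h. w1 i (x + h *\<^sub>R axis i 1) t) has_real_derivative w2 i (x + h *\<^sub>R axis i 1) t) (at h)"
proof -
  have *: "((\<lambda>k. g (x + k *\<^sub>R axis i 1)) has_real_derivative d) (at h)"
    if "((\<lambda>k. g ((x + h *\<^sub>R axis i 1) + k *\<^sub>R axis i 1)) has_real_derivative d) (at 0)"
    for g :: "real ^ 'a \<Rightarrow> real" and d
    using that DERIV_shift[of "\<lambda>k. g (x + k *\<^sub>R axis i 1)" d 0 h]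
    by (simp add: algebra_simps)
  show "((\<lambda>h. w (x + h *\<^sub>R axis i 1) t) has_real_derivative w1 i (x + h *\<^sub>R axis i 1) t) (at h)"
    by (rule *) (use assms in \<open>auto simp: heat_parts_def\<close>)
  show "((\<lambda>h. w1 i (x + h *\<^sub>R axis i 1) t) has_real_derivative w2 i (x + h *\<^sub>R axis i 1) t) (at h)"
    by (rule *[of "\<lambda>x. w1 i x t"]) (use assms in \<open>auto simp: heat_parts_def\<close>)
qed

text \<open>Since \<open>g 0 = 0\<close> at a maximum, a positive \<open>b\<close> would make
  \<open>g\<close> positive just to the right of 0, and the mean value theorem would lift
  \<open>f\<close> above \<open>f 0\<close>.\<close>

lemma second_derivative_nonpos_at_max:
  fixes f g :: "real \<Rightarrow> real"
  assumes "0 < d" and f: "\<And>h. \<bar>h\<bar> < d \<Longrightarrow> (f has_real_derivative g h) (at h)"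
    and g: "(g has_real_derivative b) (at 0)" and max: "\<And>h. \<bar>h\<bar> < d \<Longrightarrow> f h \<le> f 0"
  shows "b \<le> 0"
proof (rule ccontr)
  assume "\<not> b \<le> 0"
  have g0: "g 0 = 0"
    using DERIV_local_max[of f "g 0" 0 d] assms by auto
  obtain e where e: "e > 0" "\<And>h. h > 0 \<Longrightarrow> h < e \<Longrightarrow> g 0 < g h"
    using DERIV_pos_inc_right[OF g] \<open>\<not> b \<le> 0\<close> by auto
  define h where "h = min d e / 2"
  have h: "0 < h" "h < d" "h < e"
    using \<open>0 < d\<close> \<open>e > 0\<close> by (auto simp: h_def min_def)
  obtain z where z: "0 < z" "z < h" "f h - f 0 = (h - 0) * g z"
    using MVT2[of 0 h f g] h f by auto
  have "g z > 0" using e(2)[of z] z h g0 by auto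
  then have "f h > f 0" using z h by (simp add: algebra_simps)
  then show False using max[of h] h by auto
qed

lemma heat_on_continuous:
  assumes "heat_on P w L"
  shows "continuous_on (P \<times> {0<..}) (\<lambda>p. w (fst p) (snd p))"
  using assms by (auto simp: heat_on_def heat_parts_def)

lemma heat_on_tendsto:
  assumes "heat_on P w L" "open P" "x \<in> P" "t > 0"
  shows "((\<lambda>p. w (fst p) (snd p)) \<longlongrightarrow> w x t) (nhds (x, t))"
proof -
  have "isCont (\<lambda>p. w (fst p) (snd p)) (x, t)"
    using heat_on_continuous[OF assms(1)] assms
    by (subst (asm) continuous_on_eq_continuous_at) (auto intro: open_Times)
  then show ?thesis
    using tendsto_at_iff_tendsto_nhds[of "\<lambda>p. w (fst p) (snd p)" "(x, t)"]
    by (simp add: isCont_def)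
qed

lemma heat_on_cmult:
  assumes "heat_on P w L"
  shows "heat_on P (\<lambda>x t. c * w x t) (\<lambda>x t. c * L x t)"
proof -
  obtain wt w1 w2 where "heat_parts P w wt w1 w2"
    and L: "\<forall>x\<in>P. \<forall>t>0. L x t = wt x t - (\<Sum>i\<in>UNIV. w2 i x t)"
    using assms by (auto simp: heat_on_def)
  then have "heat_parts P (\<lambda>x t. c * w x t) (\<lambda>x t. c * wt x t) (\<lambda>i x t. c * w1 i x t) (\<lambda>i x t. c * w2 i x t)"
    unfolding heat_parts_def by (auto intro!: continuous_intros DERIV_cmult)
  with L show ?thesis
    unfolding heat_on_def
    by (intro exI conjI) (auto simp: right_diff_distrib sum_distrib_left)
qed

lemma heat_on_diff:
  assumes "heat_on P u L" "heat_on P v M"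
  shows "heat_on P (\<lambda>x t. u x t - v x t) (\<lambda>x t. L x t - M x t)"
proof -
  obtain ut u1 u2 where "heat_parts P u ut u1 u2"
    and L: "\<forall>x\<in>P. \<forall>t>0. L x t = ut x t - (\<Sum>i\<in>UNIV. u2 i x t)"
    using assms by (auto simp: heat_on_def)
  moreover obtain vt v1 v2 where "heat_parts P v vt v1 v2"
    and M: "\<forall>x\<in>P. \<forall>t>0. M x t = vt x t - (\<Sum>i\<in>UNIV. v2 i x t)"
    using assms by (auto simp: heat_on_def)
  ultimately have "heat_parts P (\<lambda>x t. u x t - v x t) (\<lambda>x t. ut x t - vt x t)
      (\<lambda>i x t. u1 i x t - v1 i x t) (\<lambda>i x t. u2 i x t - v2 i x t)"
    unfolding heat_parts_def by (auto intro!: continuous_intros DERIV_diff)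
  with L M show ?thesis
    unfolding heat_on_def by (intro exI conjI) (auto simp: algebra_simps sum_subtractf)
qed

lemma heat_on_translate:
  fixes P R :: "(real ^ 'n) set"
  assumes "heat_on P w L" "\<And>x. x \<in> R \<Longrightarrow> x + a \<in> P"
  shows "heat_on R (\<lambda>x t. w (x + a) t) (\<lambda>x t. L (x + a) t)"
proof -
  obtain wt w1 w2 where *: "heat_parts P w wt w1 w2"
    and L: "\<forall>x\<in>P. \<forall>t>0. L x t = wt x t - (\<Sum>i\<in>UNIV. w2 i x t)"
    using assms by (auto simp: heat_on_def)
  have c: "continuous_on (R \<times> {0<..}) (\<lambda>p. g (fst p + a) (snd p))"
    if "continuous_on (P \<times> {0<..}) (\<lambda>p. g (fst p) (snd p))" for g :: "real ^ 'n \<Rightarrow> real \<Rightarrow> real"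
  proof -
    have "continuous_on (R \<times> {0<..}) (\<lambda>p. (fst p + a, snd p))"
      by (intro continuous_intros)
    moreover have "(\<lambda>p. (fst p + a, snd p)) ` (R \<times> {0<..}) \<subseteq> P \<times> {0<..}"
      using assms(2) by auto
    ultimately show ?thesis using continuous_on_compose2[OF that] by fastforce
  qed
  have s: "x + h *\<^sub>R axis i 1 + a = (x + a) + h *\<^sub>R axis i 1" for x and h :: real and i :: 'n
    by (simp add: algebra_simps)
  have "heat_parts R (\<lambda>x t. w (x + a) t) (\<lambda>x t. wt (x + a) t) (\<lambda>i x t. w1 i (x + a) t) (\<lambda>i x t. w2 i (x + a) t)"
    using * assms(2) unfolding heat_parts_def s by (auto intro!: c)
  with L assms(2) show ?thesis
    unfolding heat_on_def by (intro exI conjI) auto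
qed

lemma heat_on_subset: "heat_on P w L \<Longrightarrow> R \<subseteq> P \<Longrightarrow> heat_on R w L"
  using heat_on_translate[of P w L R 0] by auto

section \<open>Maximum principle\<close>

text \<open>Boundary values enter only as eventual bounds, so \<open>w\<close> may tend to minus
  infinity at the boundary, as it does where \<open>u\<close> or a barrier blows up. The sign of
  \<open>L\<close> is assumed only where \<open>\<gamma> \<le> w\<close>, the region in which
  absorption terms can be compared; as it is strict, no perturbation of \<open>w\<close> is
  needed.\<close>

lemma parabolic_maximum_principle:
  fixes P :: "(real ^ 'n) set"
  assumes "open P" "bounded P" and H: "heat_on P w L"
    and bd: "\<And>x t. x \<in> closure P \<Longrightarrow> 0 \<le> t \<Longrightarrow> t \<le> T \<Longrightarrow> x \<notin> P \<or> t = 0 \<Longrightarrow>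
      \<forall>\<^sub>F p in at (x, t) within P \<times> {0<..}. w (fst p) (snd p) < \<gamma>"
    and neg: "\<And>x t. x \<in> P \<Longrightarrow> 0 < t \<Longrightarrow> t \<le> T \<Longrightarrow> \<gamma> \<le> w x t \<Longrightarrow> L x t < 0"
    and "x \<in> P" "0 < t" "t \<le> T"
  shows "w x t < \<gamma>"
proof (rule ccontr)
  assume "\<not> w x t < \<gamma>"
  define W where "W = (\<lambda>p. w (fst p) (snd p))"
  define S where "S = {p \<in> P \<times> {0<..T}. \<gamma> \<le> W p}"
  have "(x, t) \<in> S" using assms \<open>\<not> w x t < \<gamma>\<close> by (auto simp: S_def W_def)
  have cW: "continuous_on (P \<times> {0<..}) W" using heat_on_continuous[OF H] by (simp add: W_def)
  have "S \<subseteq> closure P \<times> {0..T}" using closure_subset by (force simp: S_def)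
  then have clS: "closure S \<subseteq> closure P \<times> {0..T}"
    by (metis closed_Times closed_atLeastAtMost closed_closure closure_minimal)
  \<comment> \<open>\<open>S\<close> is closed in space-time although
    \<open>P \<times> {0<..T}\<close> is not: by \<open>bd\<close>, lateral and initial points are
    not accumulation points of \<open>S\<close>.\<close>
  have "p \<in> S" if p: "p \<in> closure S" for p
  proof -
    obtain y s where ys: "p = (y, s)" by fastforce
    have ys': "y \<in> closure P" "0 \<le> s" "s \<le> T" using clS p ys by auto
    show "p \<in> S"
    proof (cases "y \<notin> P \<or> s = 0")
      case True
      then have "p \<notin> S" by (auto simp: S_def ys)
      then have "p islimpt S" using p by (simp add: closure_def)
      then have "at p within S \<noteq> bot" by (simp add: trivial_limit_within)
      moreover have "\<forall>\<^sub>F p in at p within P \<times> {0<..}. W p < \<gamma>"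
        using bd[OF ys' True] by (simp add: W_def ys)
      then have "\<forall>\<^sub>F r in at p within S. W r < \<gamma>"
        by (rule filter_leD[rotated]) (auto intro!: at_le simp: S_def)
      moreover have "\<forall>\<^sub>F r in at p within S. r \<in> S"
        by (simp add: eventually_at_filter)
      ultimately have "\<forall>\<^sub>F r in at p within S. W r < \<gamma> \<and> r \<in> S"
        using eventually_conj by blast
      then have "\<forall>\<^sub>F r in at p within S. False"
        by (rule eventually_mono) (auto simp: S_def)
      with \<open>at p within S \<noteq> bot\<close> show ?thesis by (simp add: trivial_limit_def)
    next
      case False
      then have "y \<in> P" "s > 0" using ys' by auto
      have "(W \<longlongrightarrow> W p) (nhds p)"
        using heat_on_tendsto[OF H \<open>open P\<close> \<open>y \<in> P\<close> \<open>s > 0\<close>] by (simp add: W_def ys)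
      have "\<gamma> \<le> W p"
      proof (rule ccontr)
        assume "\<not> \<gamma> \<le> W p"
        then have "\<forall>\<^sub>F p in nhds p. W p < \<gamma>"
          using order_tendstoD(2)[OF \<open>(W \<longlongrightarrow> W p) (nhds p)\<close>] by auto
        then obtain U where "open U" "p \<in> U" "\<forall>p\<in>U. W p < \<gamma>"
          by (auto simp: eventually_nhds)
        then have "U \<inter> S = {}" by (auto simp: S_def)
        then show False using p \<open>open U\<close> \<open>p \<in> U\<close> open_Int_closure_eq_empty by blast
      qed
      then show ?thesis using \<open>y \<in> P\<close> \<open>s > 0\<close> ys' by (auto simp: S_def ys)
    qed
  qed
  then have "closed S" using closure_subset_eq by blast
  moreover have "bounded S"
    by (rule bounded_subset[OF bounded_Times[OF \<open>bounded P\<close> bounded_closed_interval[of 0 T]]])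
       (auto simp: S_def)
  ultimately have "compact S" by (simp add: compact_eq_bounded_closed)
  moreover have "continuous_on S W" using cW by (rule continuous_on_subset) (auto simp: S_def)
  ultimately obtain m where m: "m \<in> S" "\<And>p. p \<in> S \<Longrightarrow> W p \<le> W m"
    using continuous_attains_sup[of S W] \<open>(x, t) \<in> S\<close> by (metis empty_iff)
  obtain y s where ys: "m = (y, s)" by fastforce
  have y: "y \<in> P" "0 < s" "s \<le> T" "\<gamma> \<le> w y s" using m by (auto simp: S_def ys W_def)
  have max: "w y' s' \<le> w y s" if "y' \<in> P" "0 < s'" "s' \<le> s" for y' s'
    using m(2)[of "(y', s')"] that y by (auto simp: S_def ys W_def) (metis linorder_linear order_trans)
  obtain wt w1 w2 where hp: "heat_parts P w wt w1 w2"
    and L: "\<forall>x\<in>P. \<forall>t>0. L x t = wt x t - (\<Sum>i\<in>UNIV. w2 i x t)"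
    using H by (auto simp: heat_on_def)
  \<comment> \<open>Only earlier times are compared with the maximum, so \<open>s = T\<close> needs
    no separate treatment.\<close>
  have "wt y s \<ge> 0"
  proof (rule ccontr)
    assume "\<not> wt y s \<ge> 0"
    moreover have "(w y has_real_derivative wt y s) (at s)" using hp y by (auto simp: heat_parts_def)
    ultimately obtain e where e: "e > 0" "\<And>h. h > 0 \<Longrightarrow> h < e \<Longrightarrow> w y s < w y (s - h)"
      using DERIV_neg_dec_left[of "w y"] by (meson not_le)
    define k where "k = min e s / 2"
    have "0 < k" "k < e" "k < s" using y e(1) by (auto simp: k_def min_def)
    then show False using e(2)[of k] max[of y "s - k"] y by auto
  qed
  moreover have "w2 i y s \<le> 0" for i
  proof -
    obtain d where d: "d > 0" "ball y d \<subseteq> P" using \<open>open P\<close> y openE by blast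
    have "y + h *\<^sub>R axis i 1 \<in> P" if "\<bar>h\<bar> < d" for h
      using d that by (auto simp: dist_norm subset_iff)
    then show ?thesis
      using second_derivative_nonpos_at_max[of d "\<lambda>h. w (y + h *\<^sub>R axis i 1) s"
          "\<lambda>h. w1 i (y + h *\<^sub>R axis i 1) s" "w2 i y s"] d y max
        heat_parts_deriv_along[OF hp, of y _ i s] heat_parts_deriv_along(2)[OF hp, of y 0 i s]
      by auto
  qed
  then have "(\<Sum>i\<in>UNIV. w2 i y s) \<le> 0" by (simp add: sum_nonpos)
  ultimately have "L y s \<ge> 0" using L y by auto
  then show False using neg[of y s] y by auto
qed

section \<open>Inequalities for powers\<close>

lemma powr_eq_abs_powr_mult:
  fixes r :: real
  assumes "r \<ge> 0"
  shows "\<bar>r\<bar> powr (q - 1) * r = r powr q"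
  using powr_mult_base[OF assms, of "q - 1"] assms by (simp add: mult.commute)

lemma powr_split: "r \<ge> 0 \<Longrightarrow> r powr q = r powr (q - 1) * r" for r :: real
  using powr_eq_abs_powr_mult[of r q] by simp

text \<open>With \<open>b = v - u \<ge> 0\<close> this bounds the gap in absorption
  \<open>v powr q - u powr q\<close> from below by the absorption of the difference.\<close>

lemma powr_superadditive:
  fixes a b q :: real
  assumes "q \<ge> 1" "a \<ge> 0" "b \<ge> 0"
  shows "a powr q + b powr q \<le> (a + b) powr q"
proof -
  have "a powr (q - 1) * a + b powr (q - 1) * b
      \<le> (a + b) powr (q - 1) * a + (a + b) powr (q - 1) * b"
    using assms by (intro add_mono mult_right_mono powr_mono2) auto
  then show ?thesis using assms by (simp add: powr_split[where q=q] distrib_left)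
qed

text \<open>The inductive step for multiples, with \<open>y = v - u - b\<close>. Since
  \<open>(n - 1) * y \<le> u\<close> means \<open>n * y \<le> u + y\<close>, the factor
  \<open>(n * y) powr (q - 1)\<close> is at most \<open>(u + y) powr (q - 1)\<close>, and a single
  factor \<open>n\<close> is left, as on the right-hand side. Superadditivity then makes room for
  \<open>b\<close>.\<close>

lemma powr_multiple_increment:
  fixes n q u y b :: real
  assumes "q \<ge> 1" "n \<ge> 1" "y \<ge> 0" "b \<ge> 0" "(n - 1) * y \<le> u" "u \<ge> 0"
  shows "(n * y) powr q \<le> n * ((u + y + b) powr q - u powr q - b powr q)"
proof -
  have "n * y \<le> u + y" using assms by (simp add: algebra_simps)
  have "(n * y) powr q = (n * y) powr (q - 1) * (n * y)"
    using assms by (simp add: powr_split[where q=q])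
  also have "\<dots> \<le> (u + y) powr (q - 1) * (n * y)"
    using assms \<open>n * y \<le> u + y\<close> by (intro mult_right_mono powr_mono2) auto
  also have "\<dots> = n * ((u + y) powr (q - 1) * (u + y) - (u + y) powr (q - 1) * u)"
    by (simp add: algebra_simps)
  also have "\<dots> \<le> n * ((u + y) powr (q - 1) * (u + y) - u powr (q - 1) * u)"
    using assms by (intro mult_left_mono diff_left_mono mult_right_mono powr_mono2) auto
  also have "\<dots> = n * ((u + y) powr q - u powr q)"
    using assms by (simp add: powr_split[where q=q])
  also have "\<dots> \<le> n * ((u + y + b) powr q - u powr q - b powr q)"
    using assms powr_superadditive[of q "u + y" b] by (intro mult_left_mono) auto
  finally show ?thesis .
qed

text \<open>Convexity, by the mean value theorem on either side of \<open>c\<close>; the value 0 is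
  treated apart because the derivative of \<open>powr\<close> is used at positive points
  only.\<close>

lemma powr_above_tangent:
  fixes c r q :: real
  assumes "q > 1" "c \<ge> 0" "r \<ge> 0"
  shows "c powr q + q * c powr (q - 1) * (r - c) \<le> r powr q"
proof (cases "c = 0")
  case False
  then have "c > 0" using assms by simp
  have d: "((\<lambda>x. x powr q) has_real_derivative q * x powr (q - 1)) (at x)" if "x > 0" for x :: real
    using that by (rule has_real_derivative_powr)
  consider "r = 0" | "r = c" | "0 < r" "r < c" | "c < r" using assms by linarith
  then show ?thesis
  proof cases
    case 1
    then show ?thesis using assms mult_right_mono[of 1 q "c powr q"] powr_split[of c q] by simp
  next
    case 3
    obtain z where z: "r < z" "z < c" "c powr q - r powr q = (c - r) * (q * z powr (q - 1))"
      using MVT2[OF \<open>r < c\<close>, of "\<lambda>x. x powr q" "\<lambda>z. q * z powr (q - 1)"] d \<open>0 < r\<close>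
      by (metis order_less_le_trans)
    have "(c - r) * (q * z powr (q - 1)) \<le> (c - r) * (q * c powr (q - 1))"
      using assms z 3 by (intro mult_left_mono powr_mono2) auto
    then show ?thesis using z by (simp add: algebra_simps)
  next
    case 4
    obtain z where z: "c < z" "z < r" "r powr q - c powr q = (r - c) * (q * z powr (q - 1))"
      using MVT2[OF \<open>c < r\<close>, of "\<lambda>x. x powr q" "\<lambda>z. q * z powr (q - 1)"] d \<open>0 < c\<close>
      by (metis order_less_le_trans)
    have "(r - c) * (q * c powr (q - 1)) \<le> (r - c) * (q * z powr (q - 1))"
      using assms z 4 by (intro mult_left_mono powr_mono2) auto
    then show ?thesis using z by (simp add: algebra_simps)
  qed simp
qed (use assms in auto)

section \<open>Convex functions and averages of subsolutions\<close>

text \<open>At the kink the difference quotient is \<open>max 0 z ^ (n - 1)\<close> itself,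
  continuous and zero there because \<open>n \<ge> 2\<close>; this is Caratheodory's form of the
  derivative.\<close>

lemma DERIV_ramp_power:
  fixes r :: real
  assumes "n \<ge> 2"
  shows "((\<lambda>r. max 0 r ^ n) has_real_derivative real n * max 0 r ^ (n - 1)) (at r)"
proof -
  consider "r < 0" | "r = 0" | "r > 0" by linarith
  then show ?thesis
  proof cases
    case 1
    have "((\<lambda>r. 0) has_real_derivative 0) (at r)" by simp
    then show ?thesis
      by (rule has_field_derivative_transform_within_open[where S="{..<0}", THEN DERIV_cong])
         (use 1 assms in auto)
  next
    case 2
    have "isCont (\<lambda>z. max 0 z ^ (n - 1)) r" by (intro continuous_intros)
    moreover have "max 0 z ^ n - max 0 r ^ n = max 0 z ^ (n - 1) * (z - r)" for z
      using 2 assms power_minus_mult[of n z] by (auto simp: max_def)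
    ultimately show ?thesis
      unfolding CARAT_DERIV using 2 assms by (intro exI[of _ "\<lambda>z. max 0 z ^ (n - 1)"]) auto
  next
    case 3
    have "((\<lambda>r. r ^ n) has_real_derivative real n * r ^ (n - 1)) (at r)"
      by (rule DERIV_pow[THEN DERIV_cong]) simp
    then show ?thesis
      by (rule has_field_derivative_transform_within_open[where S="{0<..}", THEN DERIV_cong])
         (use 3 in auto)
  qed
qed

text \<open>A C^2 substitute for the positive part: \<open>\<beta>2\<close> is a hat function on
  [0, 2] of integral 1, so the slope climbs from 0 to 1. Slope at most 1 gives
  \<open>\<beta> r \<le> r\<close>; increasing slope gives
  \<open>\<beta> r \<le> \<beta>1 r * r\<close>, which later transfers the absorption from the
  difference to its image under \<beta>. Positivity and monotonicity let a bound on the image be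
  translated back.\<close>

lemma convex_ramp_exists:
  obtains \<beta> \<beta>1 \<beta>2 :: "real \<Rightarrow> real"
  where "\<And>r. (\<beta> has_real_derivative \<beta>1 r) (at r)" "\<And>r. (\<beta>1 has_real_derivative \<beta>2 r) (at r)"
    "continuous_on UNIV \<beta>2" "\<And>r. \<beta>2 r \<ge> 0" "\<And>r. r \<le> 0 \<Longrightarrow> \<beta> r = 0" "\<And>r. r \<le> 0 \<Longrightarrow> \<beta>1 r = 0"
    "\<And>r. \<beta>1 r \<ge> 0" "\<And>r. r > 0 \<Longrightarrow> 0 < \<beta> r" "\<And>r. r \<ge> 0 \<Longrightarrow> \<beta> r \<le> r" "\<And>r. r \<ge> 0 \<Longrightarrow> \<beta> r \<le> \<beta>1 r * r"
    "mono \<beta>"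
proof -
  define p :: "nat \<Rightarrow> real \<Rightarrow> real" where "p n r = max 0 r ^ n" for n r
  define \<beta> where "\<beta> r = (p 3 r - 2 * p 3 (r - 1) + p 3 (r - 2)) / 6" for r
  define \<beta>1 where "\<beta>1 r = (p 2 r - 2 * p 2 (r - 1) + p 2 (r - 2)) / 2" for r
  define \<beta>2 where "\<beta>2 r = p 1 r - 2 * p 1 (r - 1) + p 1 (r - 2)" for r
  have p: "((\<lambda>r. p 3 (r - c)) has_real_derivative 3 * p 2 (r - c)) (at r)"
    "((\<lambda>r. p 2 (r - c)) has_real_derivative 2 * p 1 (r - c)) (at r)" for r c
    using DERIV_chain2[OF DERIV_ramp_power[of 3 "r - c"] DERIV_diff[OF DERIV_ident DERIV_const]]
      DERIV_chain2[OF DERIV_ramp_power[of 2 "r - c"] DERIV_diff[OF DERIV_ident DERIV_const]]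
    by (simp_all add: p_def)
  note p0 = p[where c=0, simplified]
  have d1: "(\<beta> has_real_derivative \<beta>1 r) (at r)" for r
    unfolding \<beta>_def \<beta>1_def by (auto intro!: derivative_eq_intros p p0)
  have d2: "(\<beta>1 has_real_derivative \<beta>2 r) (at r)" for r
    unfolding \<beta>1_def \<beta>2_def by (auto intro!: derivative_eq_intros p p0)
  have \<beta>2: "\<beta>2 r \<ge> 0" for r by (auto simp: \<beta>2_def p_def max_def)
  have m1: "\<beta>1 r \<le> \<beta>1 s" if "r \<le> s" for r s
    using that DERIV_nonneg_imp_nondecreasing[of r s \<beta>1] d2 \<beta>2 by blast
  have z: "\<beta> r = 0" "\<beta>1 r = 0" if "r \<le> 0" for r using that by (auto simp: \<beta>_def \<beta>1_def p_def)
  have nn: "\<beta>1 r \<ge> 0" for r using m1[of "min r 0" r] z(2)[of "min r 0"] by auto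
  have m: "\<beta> r \<le> \<beta> s" if "r \<le> s" for r s
    using that DERIV_nonneg_imp_nondecreasing[of r s \<beta>] d1 nn by blast
  then have mb: "mono \<beta>" by (simp add: mono_def)
  \<comment> \<open>For \<open>r \<ge> 2\<close> the three parabolas combine to the constant
    1.\<close>
  have le1: "\<beta>1 r \<le> 1" for r
    using m1[of r "max r 2"] by (auto simp: \<beta>1_def p_def max_def power2_eq_square algebra_simps split: if_splits)
  have pos1: "\<beta>1 r > 0" if "r > 0" for r
  proof -
    have "\<beta>1 (min r 1) = (min r 1)\<^sup>2 / 2" using that by (auto simp: \<beta>1_def p_def)
    then show ?thesis using that m1[of "min r 1" r]
      by (smt (verit) half_gt_zero zero_less_power)
  qed
  have M: "\<exists>z>0. z < r \<and> \<beta> r = r * \<beta>1 z" if "r > 0" for r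
    using MVT2[of 0 r \<beta> \<beta>1] d1 that z(1)[of 0] by auto
  have "0 < \<beta> r" "\<beta> r \<le> r" "\<beta> r \<le> \<beta>1 r * r" if r: "r > 0" for r
  proof -
    obtain z where z: "0 < z" "z < r" "\<beta> r = r * \<beta>1 z" using M[OF r] by auto
    show "0 < \<beta> r" using z pos1 by simp
    show "\<beta> r \<le> r" using z le1[of z] r mult_left_mono[of "\<beta>1 z" 1 r] by simp
    show "\<beta> r \<le> \<beta>1 r * r" using z m1[of z r] r mult_left_mono[of "\<beta>1 z" "\<beta>1 r" r] by (simp add: mult.commute)
  qed
  note pr = this
  have pr': "\<beta> r \<le> r" "\<beta> r \<le> \<beta>1 r * r" if "r \<ge> 0" for r
    using that pr[of r] z[of r] by (cases "r = 0"; simp)+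
  have c2: "continuous_on UNIV \<beta>2" unfolding \<beta>2_def p_def by (intro continuous_intros)
  show ?thesis
    by (rule that[of \<beta> \<beta>1 \<beta>2]) (fact d1 d2 c2 \<beta>2 z nn pr(1) pr' mb)+
qed

text \<open>A smooth form of Kato's inequality: the chain rule produces
  \<open>\<beta>2 (w x t)\<close> times the squared gradient, which inherits the minus sign of the
  Laplacian and is dropped because \<open>\<beta>2 \<ge> 0\<close>.\<close>

lemma heat_on_compose_convex:
  assumes "heat_on P w L"
    and d: "\<And>r. (\<beta> has_real_derivative \<beta>1 r) (at r)" "\<And>r. (\<beta>1 has_real_derivative \<beta>2 r) (at r)"
      "continuous_on UNIV \<beta>2" "\<And>r. \<beta>2 r \<ge> 0"
  obtains M where "heat_on P (\<lambda>x t. \<beta> (w x t)) M"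
    "\<And>x t. x \<in> P \<Longrightarrow> t > 0 \<Longrightarrow> M x t \<le> \<beta>1 (w x t) * L x t"
proof -
  obtain wt w1 w2 where hp: "heat_parts P w wt w1 w2"
    and L: "\<forall>x\<in>P. \<forall>t>0. L x t = wt x t - (\<Sum>i\<in>UNIV. w2 i x t)"
    using assms by (auto simp: heat_on_def)
  define W2 where "W2 i x t = \<beta>2 (w x t) * w1 i x t * w1 i x t + \<beta>1 (w x t) * w2 i x t" for i x t
  have c: "continuous_on UNIV \<beta>" "continuous_on UNIV \<beta>1"
    using d(1,2) by (auto intro!: continuous_at_imp_continuous_on DERIV_isCont)
  have cw: "continuous_on (P \<times> {0<..}) (\<lambda>p. w (fst p) (snd p))"
    and cwt: "continuous_on (P \<times> {0<..}) (\<lambda>p. wt (fst p) (snd p))"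
    and cw1: "continuous_on (P \<times> {0<..}) (\<lambda>p. w1 i (fst p) (snd p))"
    and cw2: "continuous_on (P \<times> {0<..}) (\<lambda>p. w2 i (fst p) (snd p))" for i
    using hp by (auto simp: heat_parts_def)
  note [continuous_intros] = cw cwt cw1 cw2 continuous_on_compose2[OF c(1) cw subset_UNIV]
    continuous_on_compose2[OF c(2) cw subset_UNIV] continuous_on_compose2[OF d(3) cw subset_UNIV]
  have "heat_parts P (\<lambda>x t. \<beta> (w x t)) (\<lambda>x t. \<beta>1 (w x t) * wt x t) (\<lambda>i x t. \<beta>1 (w x t) * w1 i x t) W2"
    unfolding heat_parts_def W2_def
  proof (intro conjI ballI allI impI)
    fix x t i assume x: "x \<in> P" "(t::real) > 0"
    show "((\<lambda>t. \<beta> (w x t)) has_real_derivative \<beta>1 (w x t) * wt x t) (at t)"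
      using hp x by (auto intro!: DERIV_chain2[OF d(1)] simp: heat_parts_def)
    have w: "((\<lambda>h. w (x + h *\<^sub>R axis i 1) t) has_real_derivative w1 i x t) (at 0)"
      using hp x by (auto simp: heat_parts_def)
    then show "((\<lambda>h. \<beta> (w (x + h *\<^sub>R axis i 1) t)) has_real_derivative \<beta>1 (w x t) * w1 i x t) (at 0)"
      using DERIV_chain2[OF d(1) w] by simp
    have w': "((\<lambda>h. w1 i (x + h *\<^sub>R axis i 1) t) has_real_derivative w2 i x t) (at 0)"
      using hp x by (auto simp: heat_parts_def)
    show "((\<lambda>h. \<beta>1 (w (x + h *\<^sub>R axis i 1) t) * w1 i (x + h *\<^sub>R axis i 1) t) has_real_derivative
        \<beta>2 (w x t) * w1 i x t * w1 i x t + \<beta>1 (w x t) * w2 i x t) (at 0)"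
      using DERIV_mult[OF DERIV_chain2[OF d(2) w] w'] by (simp add: algebra_simps)
  qed (intro continuous_intros)+
  moreover have "\<beta>1 (w x t) * wt x t - (\<Sum>i\<in>UNIV. W2 i x t) \<le> \<beta>1 (w x t) * L x t"
    if "x \<in> P" "t > 0" for x t
  proof -
    have "(\<Sum>i\<in>UNIV. \<beta>1 (w x t) * w2 i x t) \<le> (\<Sum>i\<in>UNIV. W2 i x t)"
      by (rule sum_mono) (use d(4)[of "w x t"] in \<open>simp add: W2_def mult.assoc\<close>)
    then show ?thesis using L that by (simp add: right_diff_distrib sum_distrib_left)
  qed
  ultimately show ?thesis
    using that[of "\<lambda>x t. \<beta>1 (w x t) * wt x t - (\<Sum>i\<in>UNIV. W2 i x t)"] by (auto simp: heat_on_def)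
qed

text \<open>The heat operator has constant coefficients, so it commutes with translations and hence
  with their averages; the joint continuity recorded in \<open>heat_parts\<close> justifies
  differentiation under the integral.\<close>

lemma heat_on_average:
  fixes P \<Omega> :: "(real ^ 'n) set"
  assumes "heat_on \<Omega> w L" "open P" and sub: "\<And>x h. x \<in> P \<Longrightarrow> h \<in> cbox a b \<Longrightarrow> x + h \<in> \<Omega>"
  shows "heat_on P (\<lambda>x t. integral (cbox a b) (\<lambda>h. w (x + h) t)) (\<lambda>x t. integral (cbox a b) (\<lambda>h. L (x + h) t))"
proof -
  obtain wt w1 w2 where hp: "heat_parts \<Omega> w wt w1 w2"
    and L: "\<forall>x\<in>\<Omega>. \<forall>t>0. L x t = wt x t - (\<Sum>i\<in>UNIV. w2 i x t)"
    using assms by (auto simp: heat_on_def)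
  define J :: "(real ^ 'n \<Rightarrow> real \<Rightarrow> real) \<Rightarrow> real ^ 'n \<Rightarrow> real \<Rightarrow> real"
    where "J g x t = integral (cbox a b) (\<lambda>h. g (x + h) t)" for g x t
  define C where "C g \<longleftrightarrow> continuous_on (\<Omega> \<times> {0<..}) (\<lambda>p. g (fst p) (snd p))"
    for g :: "real ^ 'n \<Rightarrow> real \<Rightarrow> real"
  have c: "C w" "C wt" "\<And>i. C (w1 i)" "\<And>i. C (w2 i)"
    using hp by (auto simp: heat_parts_def C_def)
  have comp: "continuous_on S (\<lambda>s. g (k s) (l s))"
    if "C g" "continuous_on S k" "continuous_on S l" "\<And>s. s \<in> S \<Longrightarrow> k s \<in> \<Omega> \<and> l s > 0"
    for g S and k :: "'z::topological_space \<Rightarrow> real ^ 'n" and l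
  proof -
    have "continuous_on S (\<lambda>s. (k s, l s))" using that by (intro continuous_intros)
    moreover have "(\<lambda>s. (k s, l s)) ` S \<subseteq> \<Omega> \<times> {0<..}" using that by auto
    ultimately show ?thesis
      using continuous_on_compose2[OF that(1)[unfolded C_def]] by fastforce
  qed
  have int: "(\<lambda>h. g (x + h) t) integrable_on cbox a b" if "C g" "x \<in> P" "t > 0" for g x t
    by (intro integrable_continuous comp[OF \<open>C g\<close>] continuous_intros) (use sub that in auto)
  have cJ: "continuous_on (P \<times> {0<..}) (\<lambda>p. J g (fst p) (snd p))" if "C g" for g
  proof -
    have "continuous_on ((P \<times> {0<..}) \<times> cbox a b) (\<lambda>s. g (fst (fst s) + snd s) (snd (fst s)))"
      by (intro comp[OF \<open>C g\<close>] continuous_intros) (use sub in auto)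
    then show ?thesis
      unfolding J_def by (intro integral_continuous_on_param) (simp add: case_prod_beta')
  qed
  have "((\<lambda>t. J w x t) has_real_derivative J wt x t) (at t)" if x: "x \<in> P" "t > 0" for x t
  proof -
    have "((\<lambda>t. integral (cbox a b) (\<lambda>h. w (x + h) t)) has_real_derivative
        integral (cbox a b) (\<lambda>h. wt (x + h) t)) (at t within {0<..})"
    proof (rule leibniz_rule_field_derivative)
      show "((\<lambda>t. w (x + h) t) has_real_derivative wt (x + h) t) (at t within {0<..})"
        if "t \<in> {0<..}" "h \<in> cbox a b" for t h
        using hp sub x that by (auto simp: heat_parts_def intro: has_field_derivative_at_within)
      have "continuous_on ({0<..} \<times> cbox a b) (\<lambda>s. wt (x + snd s) (fst s))"
        by (intro comp[OF c(2)] continuous_intros) (use sub x in auto)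
      then show "continuous_on ({0<..} \<times> cbox a b) (\<lambda>(t, h). wt (x + h) t)"
        by (simp add: case_prod_beta')
    qed (use x int[OF c(1)] in auto)
    moreover have "at t within {0<..} = at t"
      by (rule at_within_open) (use x in auto)
    ultimately show ?thesis by (simp add: J_def)
  qed
  moreover have dJ: "((\<lambda>r. J g (x + r *\<^sub>R axis i 1) t) has_real_derivative J g' x t) (at 0)"
    if x: "x \<in> P" "t > 0" and g: "C g" "C g'"
      and d: "\<And>y r. y + r *\<^sub>R axis i 1 \<in> \<Omega> \<Longrightarrow>
        ((\<lambda>r. g (y + r *\<^sub>R axis i 1) t) has_real_derivative g' (y + r *\<^sub>R axis i 1) t) (at r)"
    for x t i g g'
  proof -
    obtain \<delta> where \<delta>: "\<delta> > 0" "ball x \<delta> \<subseteq> P" using \<open>open P\<close> x openE by blast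
    have xr: "x + r *\<^sub>R axis i 1 \<in> P" if "r \<in> {-\<delta><..<\<delta>}" for r
      using \<delta> that by (auto simp: dist_norm subset_iff)
    have s: "x + r *\<^sub>R axis i 1 + h = (x + h) + r *\<^sub>R axis i 1" for r h by simp
    have "((\<lambda>r. integral (cbox a b) (\<lambda>h. g (x + r *\<^sub>R axis i 1 + h) t)) has_real_derivative
        integral (cbox a b) (\<lambda>h. g' (x + 0 *\<^sub>R axis i 1 + h) t)) (at 0 within {-\<delta><..<\<delta>})"
    proof (rule leibniz_rule_field_derivative)
      show "((\<lambda>r. g (x + r *\<^sub>R axis i 1 + h) t) has_real_derivative g' (x + r *\<^sub>R axis i 1 + h) t)
          (at r within {-\<delta><..<\<delta>})"
        if "r \<in> {-\<delta><..<\<delta>}" "h \<in> cbox a b" for r h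
        unfolding s using d sub[OF xr that(2)] that by (auto simp: s intro: has_field_derivative_at_within)
      have "continuous_on ({-\<delta><..<\<delta>} \<times> cbox a b) (\<lambda>s. g' (x + fst s *\<^sub>R axis i 1 + snd s) t)"
        by (intro comp[OF g(2)] continuous_intros) (use sub xr x in auto)
      then show "continuous_on ({-\<delta><..<\<delta>} \<times> cbox a b) (\<lambda>(r, h). g' (x + r *\<^sub>R axis i 1 + h) t)"
        by (simp add: case_prod_beta')
    qed (use xr \<delta> x int[OF g(1)] in auto)
    moreover have "at 0 within {-\<delta><..<\<delta>} = at (0::real)"
      by (rule at_within_open) (use \<delta> in auto)
    ultimately show ?thesis by (simp add: J_def)
  qed
  ultimately have "heat_parts P (J w) (J wt) (\<lambda>i. J (w1 i)) (\<lambda>i. J (w2 i))"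
    unfolding heat_parts_def
    using heat_parts_deriv_along[OF hp] c by (auto intro!: cJ dJ)
  moreover have "J L x t = J wt x t - (\<Sum>i\<in>UNIV. J (w2 i) x t)" if "x \<in> P" "t > 0" for x t
  proof -
    have "J L x t = integral (cbox a b) (\<lambda>h. wt (x + h) t - (\<Sum>i\<in>UNIV. w2 i (x + h) t))"
      unfolding J_def by (rule integral_cong) (use L sub that in auto)
    also have "\<dots> = J wt x t - integral (cbox a b) (\<lambda>h. \<Sum>i\<in>UNIV. w2 i (x + h) t)"
      unfolding J_def by (intro integral_diff int integrable_sum) (use c that in auto)
    also have "\<dots> = J wt x t - (\<Sum>i\<in>UNIV. J (w2 i) x t)"
      unfolding J_def by (subst integral_sum) (use c that in \<open>auto intro!: int\<close>)
    finally show ?thesis .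
  qed
  ultimately have "heat_on P (J w) (J L)" unfolding heat_on_def by blast
  moreover have "J = (\<lambda>g x t. integral (cbox a b) (\<lambda>h. g (x + h) t))"
    by (simp add: J_def fun_eq_iff)
  ultimately show ?thesis by simp
qed

section \<open>The barrier\<close>

text \<open>
  The exponent \<open>\<alpha>\<close> exceeds the Keller--Osserman exponent \<open>2 / (q - 1)\<close>; the surplus compensates the
  factor \<open>t\<close> that makes the barrier vanish initially. Far from the sphere the time derivative
  dominates the Laplacian, close to it the absorption does.
\<close>

lemma barrier_inequality:
  fixes q m t C :: real
  assumes "q > 1" "m > 0" "t > 0" "C > 0"
  defines "\<alpha> \<equiv> 2 * q / (q - 1)" and "A \<equiv> C powr (q / (q - 1))"
  shows "A * t * C * m powr (- \<alpha> - 2) \<le> A * m powr (- \<alpha>) + (A * t * m powr (- \<alpha>)) powr q"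
proof -
  have "A > 0" using assms by simp
  define B where "B = A * t * m powr (- \<alpha>)"
  have "B > 0" using assms \<open>A > 0\<close> by (simp add: B_def)
  have m2: "m powr (- \<alpha> - 2) = m powr (- \<alpha>) / m\<^sup>2"
    using assms by (simp add: powr_diff powr_numeral)
  have lhs: "A * t * C * m powr (- \<alpha> - 2) = B * (C / m\<^sup>2)" by (simp add: m2 B_def)
  show ?thesis
  proof (cases "t * C \<le> m\<^sup>2")
    case True
    have "A * m powr (-\<alpha>) * (t * C / m\<^sup>2) \<le> A * m powr (-\<alpha>) * 1"
      using True assms \<open>A > 0\<close> by (intro mult_left_mono) auto
    then have "A * t * C * m powr (- \<alpha> - 2) \<le> A * m powr (- \<alpha>)"
      by (simp add: m2 mult_ac)
    then show ?thesis using powr_ge_zero[of "A * t * m powr (- \<alpha>)" q] by linarith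
  next
    case False
    \<comment> \<open>Here the choices of \<open>A\<close> and \<alpha> meet: with
      \<open>\<alpha> * (q - 1) = 2 * q\<close> they turn \<open>B powr (q - 1)\<close> into exactly
      \<open>C / m\<^sup>2 * (t * C / m\<^sup>2) powr (q - 1)\<close>, whose last factor is at least
      1 in this case.\<close>
    have Aq: "A powr (q - 1) = C powr q"
      using assms by (simp add: A_def powr_powr)
    have "- \<alpha> * (q - 1) = - (2 * q)" using \<open>q > 1\<close> by (simp add: \<alpha>_def)
    then have mq: "(m powr (- \<alpha>)) powr (q - 1) = 1 / m powr (2 * q)"
      using powr_minus_divide[of m "2 * q"] by (simp only: powr_powr)
    have "1 \<le> (t * C / m\<^sup>2) powr (q - 1)"
      using False assms by (intro ge_one_powr_ge_zero) auto
    then have "C / m\<^sup>2 * 1 \<le> C / m\<^sup>2 * (t * C / m\<^sup>2) powr (q - 1)"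
      using assms by (intro mult_left_mono) auto
    also have "\<dots> = (C * C powr (q - 1)) * t powr (q - 1) / (m\<^sup>2 * (m\<^sup>2) powr (q - 1))"
      using assms by (simp add: powr_mult powr_divide)
    also have "m\<^sup>2 * (m\<^sup>2) powr (q - 1) = m powr (2 * q)"
    proof -
      have "m\<^sup>2 * (m\<^sup>2) powr (q - 1) = (m\<^sup>2) powr q"
        using powr_mult_base[of "m\<^sup>2" "q - 1"] by simp
      also have "\<dots> = (m powr 2) powr q" using \<open>m > 0\<close> by (simp add: powr_numeral)
      finally show ?thesis by (simp only: powr_powr)
    qed
    also have "C * C powr (q - 1) = C powr q"
      using assms by (simp add: powr_mult_base)
    also have "C powr q * t powr (q - 1) / m powr (2 * q) = B powr (q - 1)"
      using \<open>t > 0\<close> \<open>A > 0\<close> by (simp add: B_def powr_mult mq Aq)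
    finally have "B * (C / m\<^sup>2) \<le> B * B powr (q - 1)"
      using \<open>B > 0\<close> by (intro mult_left_mono) auto
    also have "\<dots> = B powr q" using \<open>B > 0\<close> by (simp add: powr_mult_base)
    finally have "B * (C / m\<^sup>2) \<le> B powr q" .
    moreover have "0 \<le> A * m powr (- \<alpha>)" using \<open>A > 0\<close> by simp
    ultimately show ?thesis unfolding lhs B_def[symmetric] by linarith
  qed
qed

text \<open>The barrier is a power of \<open>m x\<close>, which is smooth in the ball and vanishes
  on the sphere like the distance to it. Because of the blow-up, comparison with it requires no
  lateral information on the sphere; being linear in \<open>t\<close>, it is at most
  \<open>C * t\<close> on the half ball, the rate that is used as \<open>t\<close> tends to
  0.\<close>

lemma barrier_exists:
  fixes y :: "real ^ 'n"
  assumes "q > 1" "\<rho> > 0"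
  obtains B M C where "heat_on (ball y \<rho>) B M"
    "\<And>x t. x \<in> ball y \<rho> \<Longrightarrow> t > 0 \<Longrightarrow> B x t > 0"
    "\<And>x t. x \<in> ball y \<rho> \<Longrightarrow> t > 0 \<Longrightarrow> M x t + B x t powr q \<ge> 0"
    "\<And>K \<tau>. \<tau> > 0 \<Longrightarrow> \<exists>r<\<rho>. \<forall>x\<in>ball y \<rho>. \<forall>t\<ge>\<tau>. r < dist y x \<longrightarrow> K < B x t"
    "\<And>x t. x \<in> ball y (\<rho> / 2) \<Longrightarrow> t > 0 \<Longrightarrow> B x t \<le> C * t" "C > 0"
proof -
  define \<alpha> where "\<alpha> = 2 * q / (q - 1)"
  \<comment> \<open>Comes from the Laplacian below, where \<open>(x - y) \<bullet> (x - y)\<close>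
    and \<open>m x\<close> are both replaced by \<open>\<rho>\<^sup>2\<close>.\<close>
  define C where "C = 4 * \<alpha> * (\<alpha> + 1) * \<rho>\<^sup>2 + 2 * CARD('n) * \<alpha> * \<rho>\<^sup>2"
  define A where "A = C powr (q / (q - 1))"
  define m where "m x = \<rho>\<^sup>2 - (x - y) \<bullet> (x - y)" for x
  define B where "B x t = A * t * m x powr (- \<alpha>)" for x t
  define B1 where "B1 i x t = A * t * (2 * \<alpha>) * m x powr (- \<alpha> - 1) * ((x - y) $ i)" for i x t
  define B2 where "B2 i x t = A * t * (2 * \<alpha>) *
    (2 * (\<alpha> + 1) * m x powr (- \<alpha> - 2) * ((x - y) $ i)\<^sup>2 + m x powr (- \<alpha> - 1))" for i x t
  define Bt where "Bt x t = A * m x powr (- \<alpha>)" for x and t :: real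
  have pos: "\<alpha> > 0" using assms by (simp add: \<alpha>_def)
  then have "C > 0" using assms by (auto simp: C_def intro!: add_pos_nonneg)
  then have "A > 0" by (simp add: A_def)
  have m_eq: "m x = (\<rho> - dist y x) * (\<rho> + dist y x)" for x
    by (simp add: m_def dist_norm norm_minus_commute power2_norm_eq_inner[symmetric] power2_eq_square algebra_simps)
  have m_pos: "m x > 0" if "x \<in> ball y \<rho>" for x
    using that assms by (auto simp: m_eq intro!: mult_pos_pos add_pos_nonneg)
  have dm: "((\<lambda>h. m (x + h *\<^sub>R axis i 1)) has_real_derivative - 2 * ((x - y) $ i)) (at 0)" for x i
  proof -
    have "m (x + h *\<^sub>R axis i 1) = m x - 2 * h * ((x - y) $ i) - h * h" for h
      by (simp add: m_def inner_axis algebra_simps inner_add_left inner_add_right inner_commute axis_def[symmetric])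
    then show ?thesis by (auto intro!: derivative_eq_intros)
  qed
  have dmp: "((\<lambda>h. m (x + h *\<^sub>R axis i 1) powr s) has_real_derivative
      s * m x powr (s - 1) * (- 2 * ((x - y) $ i))) (at 0)" if "x \<in> ball y \<rho>" for x i s
    using DERIV_chain2[OF has_real_derivative_powr dm, of x i s] m_pos[OF that] by simp
  have dc: "((\<lambda>h. (x + h *\<^sub>R axis i 1 - y) $ i) has_real_derivative 1) (at 0)" for x i
    by (auto intro!: derivative_eq_intros)
  have hp: "heat_parts (ball y \<rho>) B Bt B1 B2"
    unfolding heat_parts_def
  proof (intro conjI ballI allI impI)
    have ne: "\<forall>p\<in>ball y \<rho> \<times> {0<..}. m (fst p) \<noteq> 0" using m_pos by force
    have cm: "continuous_on (ball y \<rho> \<times> {0<..}) (\<lambda>p. m (fst p))"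
      unfolding m_def by (intro continuous_intros)
    show "continuous_on (ball y \<rho> \<times> {0<..}) (\<lambda>p. B (fst p) (snd p))"
      "continuous_on (ball y \<rho> \<times> {0<..}) (\<lambda>p. Bt (fst p) (snd p))"
      "continuous_on (ball y \<rho> \<times> {0<..}) (\<lambda>p. B1 i (fst p) (snd p))"
      "continuous_on (ball y \<rho> \<times> {0<..}) (\<lambda>p. B2 i (fst p) (snd p))" for i
      unfolding B_def Bt_def B1_def B2_def by (intro continuous_intros cm ne)+
    fix x t i assume x: "x \<in> ball y \<rho>" "(t::real) > 0"
    show "(B x has_real_derivative Bt x t) (at t)"
      unfolding B_def Bt_def by (auto intro!: derivative_eq_intros)
    show "((\<lambda>h. B (x + h *\<^sub>R axis i 1) t) has_real_derivative B1 i x t) (at 0)"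
      unfolding B_def B1_def
      by (rule DERIV_cong[OF DERIV_cmult[OF dmp[OF x(1)]]]) (simp add: algebra_simps)
    show "((\<lambda>h. B1 i (x + h *\<^sub>R axis i 1) t) has_real_derivative B2 i x t) (at 0)"
      unfolding B1_def
      by (rule DERIV_cong[OF DERIV_mult[OF DERIV_cmult[OF dmp[OF x(1)]] dc]])
         (simp add: B2_def algebra_simps power2_eq_square)
  qed
  have B_pos: "B x t > 0" if "x \<in> ball y \<rho>" "t > 0" for x t
    using that \<open>A > 0\<close> m_pos[OF that(1)] by (simp add: B_def)
  have super: "Bt x t - (\<Sum>i\<in>UNIV. B2 i x t) + B x t powr q \<ge> 0" if x: "x \<in> ball y \<rho>" "t > 0" for x t
  proof -
    define E where "E = m x powr (- \<alpha> - 2)"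
    have "E > 0" using m_pos[OF x(1)] by (simp add: E_def)
    have E1: "m x powr (- \<alpha> - 1) = E * m x"
    proof -
      have "- \<alpha> - 1 = (- \<alpha> - 2) + 1" by simp
      then show ?thesis using m_pos[OF x(1)] by (simp only: powr_add E_def powr_one)
    qed
    have "(\<Sum>i\<in>UNIV. ((x - y) $ i)\<^sup>2) = (x - y) \<bullet> (x - y)"
      by (simp add: inner_vec_def power2_eq_square)
    then have "(\<Sum>i\<in>UNIV. B2 i x t)
        = A * t * (2 * \<alpha>) * (2 * (\<alpha> + 1) * E * ((x - y) \<bullet> (x - y)) + CARD('n) * (E * m x))"
      by (simp add: B2_def E_def[symmetric] E1 sum_distrib_left[symmetric] sum.distrib)
    also have "\<dots> \<le> A * t * (2 * \<alpha>) * (2 * (\<alpha> + 1) * E * \<rho>\<^sup>2 + CARD('n) * (E * \<rho>\<^sup>2))"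
    proof -
      have "(x - y) \<bullet> (x - y) \<le> \<rho>\<^sup>2" using m_pos[OF x(1)] by (simp add: m_def)
      moreover have "m x \<le> \<rho>\<^sup>2" by (simp add: m_def)
      ultimately show ?thesis
        using \<open>A > 0\<close> \<open>E > 0\<close> pos x by (intro mult_left_mono add_mono) auto
    qed
    also have "\<dots> = A * t * C * E" by (simp add: C_def algebra_simps)
    also have "\<dots> \<le> Bt x t + B x t powr q"
      using barrier_inequality[of q "m x" t C] assms \<open>C > 0\<close> m_pos[OF x(1)] x
      by (simp add: E_def Bt_def B_def A_def \<alpha>_def)
    finally show ?thesis by simp
  qed
  have blow: "\<exists>r<\<rho>. \<forall>x\<in>ball y \<rho>. \<forall>t\<ge>\<tau>. r < dist y x \<longrightarrow> K < B x t" if "\<tau> > 0" for K \<tau>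
  proof -
    define k where "k = max K 1"
    \<comment> \<open>The value of \<open>m x\<close> at which the barrier equals \<open>k\<close>
      at time \<tau>; since \<open>m x \<le> (\<rho> - dist y x) * (2 * \<rho>)\<close>, the radius
      \<open>\<rho> - \<epsilon> / (2 * \<rho>)\<close> suffices. \<open>k\<close> replaces
      \<open>K\<close> to have a positive base.\<close>
    define \<epsilon> where "\<epsilon> = (k / (A * \<tau>)) powr (- 1 / \<alpha>)"
    have "k > 0" by (simp add: k_def)
    then have "\<epsilon> > 0" using \<open>A > 0\<close> that by (simp add: \<epsilon>_def)
    have "K < B x t" if x: "x \<in> ball y \<rho>" "t \<ge> \<tau>" "\<rho> - \<epsilon> / (2 * \<rho>) < dist y x" for x t
    proof -
      have "m x < \<epsilon>"
      proof -
        have "m x \<le> (\<rho> - dist y x) * (2 * \<rho>)"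
          unfolding m_eq using x assms by (intro mult_left_mono) auto
        also have "\<dots> < \<epsilon> / (2 * \<rho>) * (2 * \<rho>)"
          using x assms by (intro mult_strict_right_mono) auto
        also have "\<dots> = \<epsilon>" using assms by simp
        finally show ?thesis .
      qed
      then have "\<epsilon> powr (- \<alpha>) < m x powr (- \<alpha>)"
        using m_pos[OF x(1)] pos by (intro powr_less_mono2_neg) auto
      moreover have "\<epsilon> powr (- \<alpha>) = k / (A * \<tau>)"
        using pos \<open>k > 0\<close> \<open>A > 0\<close> \<open>\<tau> > 0\<close> by (simp add: \<epsilon>_def powr_powr)
      ultimately have "k < A * \<tau> * m x powr (- \<alpha>)"
        using \<open>A > 0\<close> \<open>\<tau> > 0\<close> by (simp add: field_simps)
      also have "\<dots> \<le> B x t"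
        unfolding B_def using x \<open>A > 0\<close> by (intro mult_right_mono mult_left_mono) auto
      finally show ?thesis by (simp add: k_def)
    qed
    then show ?thesis using \<open>\<epsilon> > 0\<close> assms by (intro exI[of _ "\<rho> - \<epsilon> / (2 * \<rho>)"]) auto
  qed
  have small: "B x t \<le> A * (\<rho>\<^sup>2 / 2) powr (- \<alpha>) * t" if x: "x \<in> ball y (\<rho> / 2)" "t > 0" for x t
  proof -
    have "(dist y x)\<^sup>2 \<le> (\<rho> / 2)\<^sup>2" using x by (intro power_mono) auto
    then have "(dist y x)\<^sup>2 \<le> \<rho>\<^sup>2 / 4" by (simp add: power_divide)
    moreover have "m x = \<rho>\<^sup>2 - (dist y x)\<^sup>2" by (simp add: m_eq power2_eq_square algebra_simps)
    ultimately have "\<rho>\<^sup>2 / 2 \<le> m x"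
      using zero_le_power2[of "dist y x"] by linarith
    then have "m x powr (- \<alpha>) \<le> (\<rho>\<^sup>2 / 2) powr (- \<alpha>)"
      using assms pos by (intro powr_mono2') auto
    then show ?thesis using \<open>A > 0\<close> x by (simp add: B_def mult_left_mono)
  qed
  show ?thesis
    by (rule that[of B "\<lambda>x t. Bt x t - (\<Sum>i\<in>UNIV. B2 i x t)" "A * (\<rho>\<^sup>2 / 2) powr (- \<alpha>)"])
       (use hp B_pos super blow small \<open>A > 0\<close> assms in \<open>auto simp: heat_on_def\<close>)
qed

section \<open>The initial trace\<close>

text \<open>Jensen's inequality: the tangent inequality at the mean is integrated, and the linear
  term integrates to 0.\<close>

lemma powr_mean_le:
  fixes g :: "'a::euclidean_space \<Rightarrow> real"
  assumes "q > 1" "continuous_on (cbox a b) g" "\<And>h. h \<in> cbox a b \<Longrightarrow> g h \<ge> 0"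
    and c: "measure lborel (cbox a b) > 0"
  shows "measure lborel (cbox a b) * (integral (cbox a b) g / measure lborel (cbox a b)) powr q
    \<le> integral (cbox a b) (\<lambda>h. g h powr q)"
proof -
  define k where "k = measure lborel (cbox a b)"
  define m where "m = integral (cbox a b) g / k"
  have g: "g integrable_on cbox a b" by (rule integrable_continuous) fact
  have "m \<ge> 0" using assms by (simp add: m_def k_def integral_nonneg[OF g])
  have gq: "(\<lambda>h. g h powr q) integrable_on cbox a b"
    using assms by (intro integrable_continuous continuous_on_powr') auto
  have ci: "(\<lambda>h. s) integrable_on cbox a b" for s :: real by (rule integrable_const)
  have "k * m powr q = k * m powr q + q * m powr (q - 1) * (integral (cbox a b) g - k * m)"
    using c by (simp add: m_def k_def)
  also have "\<dots> = integral (cbox a b) (\<lambda>h. m powr q + q * m powr (q - 1) * (g h - m))"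
    by (subst integral_add | subst integral_mult_right | subst integral_diff |
        intro integrable_diff integrable_on_mult_right g ci | simp add: k_def)+
  also have "\<dots> \<le> integral (cbox a b) (\<lambda>h. g h powr q)"
    using assms \<open>m \<ge> 0\<close>
    by (intro integral_le powr_above_tangent integrable_add integrable_on_mult_right integrable_diff g gq ci) auto
  finally show ?thesis by (simp add: m_def k_def)
qed

text \<open>The common trace \<open>f\<close> cancels in the triangle inequality. The statement
  passes from Lebesgue set integrals to \<open>integral\<close>, the form in which averages over
  cubes are taken, so integrability is part of the conclusion.\<close>

lemma tendsto_L1_loc_difference:
  fixes \<Omega> :: "(real ^ 'n) set"
  assumes u: "tendsto_L1_loc \<Omega> (\<lambda>t x. u x t) f F" and v: "tendsto_L1_loc \<Omega> (\<lambda>t x. v x t) f F"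
    and K: "compact K" "K \<subseteq> \<Omega>" and "\<eta> > 0"
  shows "\<forall>\<^sub>F t in F. (\<lambda>x. \<bar>v x t - u x t\<bar>) integrable_on K \<and>
    integral K (\<lambda>x. \<bar>v x t - u x t\<bar>) < \<eta>"
proof -
  have U: "\<forall>\<^sub>F t in F. (\<lambda>x. u x t - f x) absolutely_integrable_on K"
    "\<forall>\<^sub>F t in F. (LINT x:K|lebesgue. \<bar>u x t - f x\<bar>) < \<eta> / 2"
    using u K \<open>\<eta> > 0\<close> order_tendstoD(2)[of "\<lambda>t. LINT x:K|lebesgue. \<bar>u x t - f x\<bar>" 0 F "\<eta> / 2"]
    by (auto simp: tendsto_L1_loc_def)
  have V: "\<forall>\<^sub>F t in F. (\<lambda>x. v x t - f x) absolutely_integrable_on K"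
    "\<forall>\<^sub>F t in F. (LINT x:K|lebesgue. \<bar>v x t - f x\<bar>) < \<eta> / 2"
    using v K \<open>\<eta> > 0\<close> order_tendstoD(2)[of "\<lambda>t. LINT x:K|lebesgue. \<bar>v x t - f x\<bar>" 0 F "\<eta> / 2"]
    by (auto simp: tendsto_L1_loc_def)
  from U V show ?thesis
  proof eventually_elim
    case (elim t)
    have au: "(\<lambda>x. \<bar>u x t - f x\<bar>) absolutely_integrable_on K"
      and av: "(\<lambda>x. \<bar>v x t - f x\<bar>) absolutely_integrable_on K"
      using elim(1,3) by (auto intro: set_integrable_abs)
    have "(\<lambda>x. (v x t - f x) - (u x t - f x)) absolutely_integrable_on K"
      by (rule set_integral_diff(1)[OF elim(3,1)])
    then have a: "(\<lambda>x. \<bar>v x t - u x t\<bar>) absolutely_integrable_on K"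
      by (auto intro: set_integrable_abs)
    note i = set_lebesgue_integral_eq_integral(1)
    have "integral K (\<lambda>x. \<bar>v x t - u x t\<bar>) \<le> integral K (\<lambda>x. \<bar>v x t - f x\<bar> + \<bar>u x t - f x\<bar>)"
      by (intro integral_le integrable_add i[OF a] i[OF au] i[OF av]) linarith
    also have "\<dots> = integral K (\<lambda>x. \<bar>v x t - f x\<bar>) + integral K (\<lambda>x. \<bar>u x t - f x\<bar>)"
      by (intro integral_add i[OF au] i[OF av])
    also have "\<dots> < \<eta>"
      using elim set_lebesgue_integral_eq_integral(2)[OF au] set_lebesgue_integral_eq_integral(2)[OF av]
      by simp
    finally show ?case using i[OF a] by simp
  qed
qed

lemma positive_large_solution_heat_on:
  assumes "positive_large_solution q \<Omega> f u"
  shows "heat_on \<Omega> u (\<lambda>x t. - (u x t powr q))"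
proof -
  define D1 where "D1 i x t = partial_deriv i (\<lambda>y. u y t) x" for i x t
  define D2 where "D2 i x t = partial_deriv i (partial_deriv i (\<lambda>y. u y t)) x" for i x t
  have C: "C21_on \<Omega> u" and pos: "\<And>x t. x \<in> \<Omega> \<Longrightarrow> t > 0 \<Longrightarrow> u x t > 0"
    and eq: "\<And>x t. x \<in> \<Omega> \<Longrightarrow> t > 0 \<Longrightarrow>
      deriv (u x) t - laplacian (\<lambda>y. u y t) x + \<bar>u x t\<bar> powr (q - 1) * u x t = 0"
    using assms by (auto simp: positive_large_solution_def classical_solution_def)
  have d: "(g has_real_derivative deriv g s) (at s)" if "g differentiable (at s)" for g :: "real \<Rightarrow> real" and s
    using that by (simp add: DERIV_deriv_iff_real_differentiable)
  have "((\<lambda>h. u (x + h *\<^sub>R axis i 1) t) has_real_derivative D1 i x t) (at 0)"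
    "((\<lambda>h. D1 i (x + h *\<^sub>R axis i 1) t) has_real_derivative D2 i x t) (at 0)"
    if "x \<in> \<Omega>" "t > 0" for x t i
    using C that unfolding C21_on_def has_partial_deriv_at_def D1_def D2_def partial_deriv_def
    by (auto intro!: d)
  then have "heat_parts \<Omega> u (\<lambda>x. deriv (u x)) D1 D2"
    using C d unfolding heat_parts_def C21_on_def by (auto simp: case_prod_beta' D1_def D2_def)
  moreover have "- (u x t powr q) = deriv (u x) t - (\<Sum>i\<in>UNIV. D2 i x t)" if "x \<in> \<Omega>" "t > 0" for x t
    using eq[OF that] powr_eq_abs_powr_mult[of "u x t" q] pos[OF that]
    by (simp add: laplacian_def D2_def)
  ultimately show ?thesis unfolding heat_on_def by blast
qed

lemma heat_on_continuous_slice: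
  assumes "heat_on \<Omega> w L" "t > 0" "continuous_on S k" "\<And>s. s \<in> S \<Longrightarrow> k s \<in> \<Omega>"
  shows "continuous_on S (\<lambda>s. w (k s) t)"
proof -
  have "continuous_on S (\<lambda>s. (k s, t))" using assms by (intro continuous_intros)
  moreover have "(\<lambda>s. (k s, t)) ` S \<subseteq> \<Omega> \<times> {0<..}" using assms by auto
  ultimately show ?thesis
    using continuous_on_compose2[OF heat_on_continuous[OF assms(1)]] by fastforce
qed

lemma eventually_at_within_spacetime:
  fixes y :: "'a::topological_space" and s :: real
  assumes "open U" "y \<in> U" "open V" "s \<in> V"
  shows "\<forall>\<^sub>F p in at (y, s) within P \<times> {0<..}. fst p \<in> P \<and> fst p \<in> U \<and> snd p > 0 \<and> snd p \<in> V"
  unfolding eventually_at_topological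
  by (rule exI[of _ "U \<times> V"]) (use assms in \<open>auto intro: open_Times\<close>)

text \<open>
  The initial data are attained only in \<open>L\<^sup>1\<^sub>l\<^sub>o\<^sub>c\<close>. Averages over small cubes of \<open>\<beta> (v - u)\<close>, where \<open>\<beta>\<close>
  is a smooth version of the positive part, are still subsolutions by Jensen's inequality, but tend
  to \<open>0\<close> uniformly, hence stay below the barrier whatever the size of the cubes.
\<close>

lemma difference_small_initially:
  fixes \<Omega> :: "(real ^ 'n) set"
  assumes "q > 1" "open \<Omega>" "x0 \<in> \<Omega>" "\<epsilon> > 0"
    and u: "positive_large_solution q \<Omega> f u" and v: "positive_large_solution q \<Omega> f v"
  shows "\<forall>\<^sub>F p in at (x0, 0) within \<Omega> \<times> {0<..}. v (fst p) (snd p) - u (fst p) (snd p) < \<epsilon>"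
proof -
  \<comment> \<open>Room for three radii: the comparison takes place in radius \<rho>, the averages
    are defined in radius \<open>2 * \<rho>\<close>, and their cubes reach into radius
    \<open>3 * \<rho>\<close>.\<close>
  obtain \<rho> where \<rho>: "\<rho> > 0" "cball x0 (3 * \<rho>) \<subseteq> \<Omega>"
  proof -
    obtain r where "r > 0" "cball x0 r \<subseteq> \<Omega>"
      using \<open>open \<Omega>\<close> \<open>x0 \<in> \<Omega>\<close> open_contains_cball by blast
    then show ?thesis using that[of "r / 3"] by simp
  qed
  have pos: "u x t > 0" "v x t > 0" if "x \<in> \<Omega>" "t > 0" for x t
    using u v that by (auto simp: positive_large_solution_def)
  note hu = positive_large_solution_heat_on[OF u] and hv = positive_large_solution_heat_on[OF v]
  obtain \<beta> \<beta>1 \<beta>2 :: "real \<Rightarrow> real" where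
    d: "\<And>r. (\<beta> has_real_derivative \<beta>1 r) (at r)" "\<And>r. (\<beta>1 has_real_derivative \<beta>2 r) (at r)"
      "continuous_on UNIV \<beta>2" "\<And>r. \<beta>2 r \<ge> 0"
    and \<beta>0: "\<And>r. r \<le> 0 \<Longrightarrow> \<beta> r = 0" "\<And>r. r \<le> 0 \<Longrightarrow> \<beta>1 r = 0" and \<beta>1: "\<And>r. \<beta>1 r \<ge> 0"
    and \<beta>: "\<And>r. r > 0 \<Longrightarrow> 0 < \<beta> r" "\<And>r. r \<ge> 0 \<Longrightarrow> \<beta> r \<le> r" "\<And>r. r \<ge> 0 \<Longrightarrow> \<beta> r \<le> \<beta>1 r * r"
    and mono: "mono \<beta>"
    using convex_ramp_exists by metis
  define w where "w x t = \<beta> (v x t - u x t)" for x t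
  obtain L where hw: "heat_on \<Omega> w L"
    and L: "\<And>x t. x \<in> \<Omega> \<Longrightarrow> t > 0 \<Longrightarrow> L x t \<le> \<beta>1 (v x t - u x t) * (- (v x t powr q) - - (u x t powr q))"
    using heat_on_compose_convex[OF heat_on_diff[OF hv hu] d] unfolding w_def by blast
  have w_nonneg: "w x t \<ge> 0" for x t
    using \<beta>(1)[of "v x t - u x t"] \<beta>0(1)[of "v x t - u x t"] by (fastforce simp: w_def)
  have w_le: "w x t \<le> \<bar>v x t - u x t\<bar>" for x t
    using \<beta>(2)[of "v x t - u x t"] \<beta>0(1)[of "v x t - u x t"] by (fastforce simp: w_def)
  \<comment> \<open>Both bounds on \<beta> are used: \<open>\<beta> z \<le> z\<close> in the power
    \<open>q - 1\<close>, and \<open>\<beta> z \<le> \<beta>1 z * z\<close> in the remaining factor,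
    which yields the weight \<open>\<beta>1 z\<close> of the source term.\<close>
  have sub: "L x t \<le> - (w x t powr q)" if x: "x \<in> \<Omega>" "t > 0" for x t
  proof (cases "v x t - u x t \<le> 0")
    case True
    then show ?thesis using L[OF x] \<beta>0 by (simp add: w_def)
  next
    case False
    define z where "z = v x t - u x t"
    have z: "z > 0" "v x t = u x t + z" using False by (auto simp: z_def)
    have b: "\<beta> z > 0" "\<beta> z \<le> z" "\<beta> z \<le> \<beta>1 z * z" using \<beta>[of z] z by auto
    have "w x t powr q = \<beta> z powr (q - 1) * \<beta> z"
      using b powr_split[of "\<beta> z" q] by (simp add: w_def z_def)
    also have "\<dots> \<le> z powr (q - 1) * (\<beta>1 z * z)"
      using b \<open>q > 1\<close> by (intro mult_mono powr_mono2) auto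
    also have "\<dots> = \<beta>1 z * z powr q" using z powr_split[of z q] by simp
    also have "\<dots> \<le> \<beta>1 z * (v x t powr q - u x t powr q)"
      using powr_superadditive[of q "u x t" z] z \<open>q > 1\<close> pos[OF x] \<beta>1
      by (intro mult_left_mono) auto
    finally show ?thesis using L[OF x] by (simp add: z_def algebra_simps)
  qed
  obtain B M C where B: "heat_on (ball x0 \<rho>) B M"
    "\<And>x t. x \<in> ball x0 \<rho> \<Longrightarrow> t > 0 \<Longrightarrow> B x t > 0"
    "\<And>x t. x \<in> ball x0 \<rho> \<Longrightarrow> t > 0 \<Longrightarrow> M x t + B x t powr q \<ge> 0"
    "\<And>K \<tau>. \<tau> > 0 \<Longrightarrow> \<exists>r<\<rho>. \<forall>x\<in>ball x0 \<rho>. \<forall>t\<ge>\<tau>. r < dist x0 x \<longrightarrow> K < B x t"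
    "\<And>x t. x \<in> ball x0 (\<rho> / 2) \<Longrightarrow> t > 0 \<Longrightarrow> B x t \<le> C * t" "C > 0"
    by (rule barrier_exists[OF \<open>q > 1\<close> \<open>\<rho> > 0\<close>, of x0]) blast
  \<comment> \<open>Near a point violating the bound, continuity of \<open>w\<close> allows a cube
    so small that the average still exceeds \<open>B\<close> by \<eta>. The cube depends on the
    point, but the barrier does not.\<close>
  have wB: "w x t \<le> B x t" if x: "x \<in> ball x0 \<rho>" "t > 0" for x t
  proof (rule ccontr)
    assume "\<not> w x t \<le> B x t"
    define \<eta> where "\<eta> = (w x t - B x t) / 2"
    have "\<eta> > 0" using \<open>\<not> w x t \<le> B x t\<close> by (simp add: \<eta>_def)
    have x\<Omega>: "x \<in> \<Omega>" using x \<rho> by auto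
    have "continuous_on \<Omega> (\<lambda>y. w y t)"
      using x by (intro heat_on_continuous_slice[OF hw] continuous_intros)
    then have "isCont (\<lambda>y. w y t) x"
      using \<open>open \<Omega>\<close> x\<Omega> by (simp add: continuous_on_eq_continuous_at)
    then obtain \<delta>0 where \<delta>0: "\<delta>0 > 0" "\<And>y. dist y x < \<delta>0 \<Longrightarrow> \<bar>w y t - w x t\<bar> < \<eta>"
      using \<open>\<eta> > 0\<close> unfolding continuous_at_eps_delta by (auto simp: dist_norm)
    obtain a b :: "real ^ 'n" where ab: "cbox a b \<subseteq> ball 0 (min \<delta>0 \<rho>)"
      "0 \<in> box a b" "\<forall>i\<in>Basis. a \<bullet> i < b \<bullet> i"
      by (rule open_contains_cbox[of "ball 0 (min \<delta>0 \<rho>)" 0]) (use \<delta>0 \<rho> in auto)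
    define k where "k = measure lborel (cbox a b)"
    have "k > 0" using content_pos_lt[OF ab(3)] by (simp add: k_def)
    have h: "norm h < \<delta>0" "norm h < \<rho>" if "h \<in> cbox a b" for h using ab(1) that by auto
    have in\<Omega>: "y + h \<in> cball x0 (3 * \<rho>)" if "y \<in> ball x0 (2 * \<rho>)" "h \<in> cbox a b" for y h
    proof -
      have "dist x0 (y + h) \<le> dist x0 y + norm h"
        using dist_triangle[of x0 "y + h" y] by (simp add: dist_norm)
      then show ?thesis using that h[OF that(2)] by simp
    qed
    define W where "W y s = (1 / k) * integral (cbox a b) (\<lambda>h. w (y + h) s)" for y s
    define N where "N y s = (1 / k) * integral (cbox a b) (\<lambda>h. L (y + h) s)" for y s
    have hW: "heat_on (ball x0 (2 * \<rho>)) W N"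
      unfolding W_def N_def
      by (intro heat_on_cmult heat_on_average[OF hw]) (use in\<Omega> \<rho> in auto)
    have cw: "continuous_on (cbox a b) (\<lambda>h. w (y + h) s)" if "y \<in> ball x0 (2 * \<rho>)" "s > 0" for y s
      using in\<Omega>[OF that(1)] \<rho> that(2)
      by (intro heat_on_continuous_slice[OF hw] continuous_intros) auto
    have "W x t \<ge> B x t + \<eta>"
    proof -
      have "k * (B x t + \<eta>) = integral (cbox a b) (\<lambda>h. B x t + \<eta>)" by (simp add: k_def)
      also have "\<dots> \<le> integral (cbox a b) (\<lambda>h. w (x + h) t)"
      proof (intro integral_le integrable_const integrable_continuous cw)
        fix y assume "y \<in> cbox a b"
        then show "B x t + \<eta> \<le> w (x + y) t"
          using \<delta>0(2)[of "x + y"] h by (simp add: dist_norm \<eta>_def field_simps abs_if split: if_splits)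
      qed (use x \<rho> in auto)
      finally show ?thesis using \<open>k > 0\<close> by (simp add: W_def field_simps)
    qed
    moreover have "W x t - B x t < \<eta>"
    proof (rule parabolic_maximum_principle[where w="\<lambda>x t. W x t - B x t" and P="ball x0 \<rho>" and T=t])
      have "ball x0 \<rho> \<subseteq> ball x0 (2 * \<rho>)" using \<rho> by auto
      then show "heat_on (ball x0 \<rho>) (\<lambda>x t. W x t - B x t) (\<lambda>x t. N x t - M x t)"
        by (intro heat_on_diff heat_on_subset[OF hW] B(1))
      show "N y s - M y s < 0" if y: "y \<in> ball x0 \<rho>" "0 < s" "s \<le> t" "\<eta> \<le> W y s - B y s" for y s
      proof -
        have y2: "y \<in> ball x0 (2 * \<rho>)" using y \<rho> by auto
        have y\<Omega>: "y + h \<in> \<Omega>" if "h \<in> cbox a b" for h using in\<Omega>[OF y2 that] \<rho> by auto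
        \<comment> \<open>\<open>heat_on\<close> asserts no continuity of \<open>L\<close>; on
          \<Omega> it comes from that of the derivatives.\<close>
        have i: "(\<lambda>h. L (y + h) s) integrable_on cbox a b"
        proof -
          obtain wt w1 w2 where hp: "heat_parts \<Omega> w wt w1 w2"
            and L: "\<forall>x\<in>\<Omega>. \<forall>t>0. L x t = wt x t - (\<Sum>i\<in>UNIV. w2 i x t)"
            using hw by (auto simp: heat_on_def)
          have "continuous_on (\<Omega> \<times> {0<..}) (\<lambda>p. wt (fst p) (snd p) - (\<Sum>i\<in>UNIV. w2 i (fst p) (snd p)))"
            using hp by (intro continuous_intros) (auto simp: heat_parts_def)
          moreover have "continuous_on (cbox a b) (\<lambda>h. (y + h, s))" by (intro continuous_intros)
          moreover have "(\<lambda>h. (y + h, s)) ` cbox a b \<subseteq> \<Omega> \<times> {0<..}" using y\<Omega> y by auto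
          ultimately have "continuous_on (cbox a b) (\<lambda>h. wt (y + h) s - (\<Sum>i\<in>UNIV. w2 i (y + h) s))"
            using continuous_on_compose2 by fastforce
          then have "continuous_on (cbox a b) (\<lambda>h. L (y + h) s)"
            by (rule continuous_on_eq) (use L y\<Omega> y in auto)
          then show ?thesis by (rule integrable_continuous)
        qed
        have "W y s powr q \<le> (1 / k) * integral (cbox a b) (\<lambda>h. w (y + h) s powr q)"
          using powr_mean_le[OF \<open>q > 1\<close> cw[OF y2 y(2)] w_nonneg] \<open>k > 0\<close>
          by (simp add: W_def k_def field_simps)
        also have "\<dots> \<le> (1 / k) * integral (cbox a b) (\<lambda>h. - L (y + h) s)"
          using \<open>k > 0\<close> sub[OF y\<Omega> y(2)] cw[OF y2 y(2)] w_nonneg \<open>q > 1\<close>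
          by (intro mult_left_mono integral_le integrable_neg i integrable_continuous continuous_on_powr')
             (force intro!: continuous_intros)+
        also have "\<dots> = - N y s" by (simp add: N_def)
        finally have "N y s \<le> - (W y s powr q)" by simp
        moreover have "B y s powr q < W y s powr q"
          using B(2)[OF y(1,2)] y(4) \<open>\<eta> > 0\<close> \<open>q > 1\<close> by (intro powr_less_mono2) auto
        ultimately show ?thesis using B(3)[OF y(1,2)] by linarith
      qed
      show "\<forall>\<^sub>F p in at (y, s) within ball x0 \<rho> \<times> {0<..}. W (fst p) (snd p) - B (fst p) (snd p) < \<eta>"
        if y: "y \<in> closure (ball x0 \<rho>)" "0 \<le> s" "s \<le> t" "y \<notin> ball x0 \<rho> \<or> s = 0" for y s
      proof (cases "s = 0")
        case True
        have "\<forall>\<^sub>F s in at_right 0. (\<lambda>x. \<bar>v x s - u x s\<bar>) integrable_on cball x0 (3 * \<rho>) \<and>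
            integral (cball x0 (3 * \<rho>)) (\<lambda>x. \<bar>v x s - u x s\<bar>) < k * \<eta>"
          using u v \<rho> \<open>k > 0\<close> \<open>\<eta> > 0\<close>
          by (intro tendsto_L1_loc_difference[of \<Omega> u f _ v]) (auto simp: positive_large_solution_def)
        then obtain \<tau> where \<tau>: "\<tau> > 0" "\<And>s. 0 < s \<Longrightarrow> s < \<tau> \<Longrightarrow>
            (\<lambda>x. \<bar>v x s - u x s\<bar>) integrable_on cball x0 (3 * \<rho>) \<and>
            integral (cball x0 (3 * \<rho>)) (\<lambda>x. \<bar>v x s - u x s\<bar>) < k * \<eta>"
          unfolding eventually_at_right_field by auto
        \<comment> \<open>The average is at most \<open>1 / k\<close> times the integral over one
          fixed ball, hence small uniformly in the centre \<open>x'\<close>, up to the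
          sphere.\<close>
        have small: "W x' s' - B x' s' < \<eta>" if "x' \<in> ball x0 \<rho>" "0 < s'" "s' < \<tau>" for x' s'
        proof -
          have x': "x' \<in> ball x0 (2 * \<rho>)" using that \<rho> by auto
          have cb: "cbox (a + x') (b + x') \<subseteq> cball x0 (3 * \<rho>)"
          proof
            fix z assume "z \<in> cbox (a + x') (b + x')"
            then have "z - x' \<in> cbox a b" by (simp add: mem_box inner_simps algebra_simps)
            then show "z \<in> cball x0 (3 * \<rho>)" using in\<Omega>[OF x', of "z - x'"] by simp
          qed
          have cwz: "continuous_on (cbox (a + x') (b + x')) (\<lambda>z. w z s')"
            using cb \<rho> that(2) by (intro heat_on_continuous_slice[OF hw] continuous_intros) auto
          have cuv: "continuous_on (cbox (a + x') (b + x')) (\<lambda>z. \<bar>v z s' - u z s'\<bar>)"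
            using cb \<rho> that(2)
            by (intro continuous_on_rabs heat_on_continuous_slice[OF heat_on_diff[OF hv hu]] continuous_intros) auto
          have "k * W x' s' = integral (cbox a b) ((\<lambda>z. w z s') \<circ> ((+) x'))"
            using \<open>k > 0\<close> by (simp add: W_def o_def)
          also have "\<dots> = integral (cbox (a + x') (b + x')) (\<lambda>z. w z s')"
            by (rule integral_shift_cbox_plus)
          also have "\<dots> \<le> integral (cbox (a + x') (b + x')) (\<lambda>z. \<bar>v z s' - u z s'\<bar>)"
            by (intro integral_le integrable_continuous cwz cuv w_le)
          also have "\<dots> \<le> integral (cball x0 (3 * \<rho>)) (\<lambda>z. \<bar>v z s' - u z s'\<bar>)"
            using \<tau>(2)[OF that(2,3)] by (intro integral_subset_le integrable_continuous cuv cb) auto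
          also have "\<dots> < k * \<eta>" using \<tau>(2)[OF that(2,3)] by simp
          finally have "W x' s' < \<eta>" using \<open>k > 0\<close> by simp
          then show ?thesis using B(2)[OF that(1,2)] by simp
        qed
        show ?thesis
          using eventually_at_within_spacetime[of UNIV y "{..<\<tau>}" s "ball x0 \<rho>"] \<tau>(1) True
          by (auto elim!: eventually_mono intro: small)
      next
        case False
        then have s: "s > 0" and y': "dist x0 y = \<rho>" using y \<rho> by auto
        then have y2: "y \<in> ball x0 (2 * \<rho>)" using \<rho> by auto
        \<comment> \<open>\<open>W\<close> is still continuous at \<open>y\<close>, being defined in
          the ball of double radius, while \<open>B\<close> blows up uniformly for times above
          \<open>s / 2\<close>.\<close>
        obtain r where r: "r < \<rho>" "\<And>x t. x \<in> ball x0 \<rho> \<Longrightarrow> t \<ge> s / 2 \<Longrightarrow> r < dist x0 x \<Longrightarrow> W y s + 1 - \<eta> < B x t"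
          using B(4)[of "s / 2" "W y s + 1 - \<eta>"] s by auto
        have t1: "((\<lambda>p. W (fst p) (snd p)) \<longlongrightarrow> W y s) (at (y, s) within ball x0 \<rho> \<times> {0<..})"
          using heat_on_tendsto[OF hW open_ball y2 s] by (rule tendsto_mono[rotated]) (simp add: at_within_def)
        have "\<forall>\<^sub>F p in at (y, s) within ball x0 \<rho> \<times> {0<..}. fst p \<in> ball x0 \<rho> \<and>
            fst p \<in> - cball x0 r \<and> snd p > 0 \<and> snd p \<in> {s / 2<..}"
          by (rule eventually_at_within_spacetime) (use y' r s in auto)
        moreover have "\<forall>\<^sub>F p in at (y, s) within ball x0 \<rho> \<times> {0<..}. W (fst p) (snd p) < W y s + 1"
          using order_tendstoD(2)[OF t1] by simp
        ultimately show ?thesis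
        proof eventually_elim
          case (elim p)
          then show ?case using r(2)[of "fst p" "snd p"] by force
        qed
      qed
    qed (use x in auto)
    ultimately show False by simp
  qed
  \<comment> \<open>Below this time \<open>C * t < \<beta> \<epsilon>\<close>, and by monotonicity
    of \<beta> a difference of at least \<epsilon> is excluded.\<close>
  define \<tau> where "\<tau> = \<beta> \<epsilon> / C"
  have "\<tau> > 0" using \<beta>(1)[OF \<open>\<epsilon> > 0\<close>] \<open>C > 0\<close> by (simp add: \<tau>_def)
  have "v x t - u x t < \<epsilon>" if x: "x \<in> ball x0 (\<rho> / 2)" "0 < t" "t < \<tau>" for x t
  proof (rule ccontr)
    assume "\<not> v x t - u x t < \<epsilon>"
    then have "\<beta> \<epsilon> \<le> w x t" using mono by (simp add: w_def mono_def)
    also have "\<dots> \<le> C * t" using wB[of x t] B(5)[OF x(1,2)] x \<rho> by force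
    also have "\<dots> < \<beta> \<epsilon>" using x(3) \<open>C > 0\<close> by (simp add: \<tau>_def field_simps)
    finally show False by simp
  qed
  moreover have "\<forall>\<^sub>F p in at (x0, 0) within \<Omega> \<times> {0<..}. fst p \<in> \<Omega> \<and>
      fst p \<in> ball x0 (\<rho> / 2) \<and> snd p > 0 \<and> snd p \<in> {..<\<tau>}"
    by (rule eventually_at_within_spacetime) (use \<open>\<tau> > 0\<close> \<rho> in auto)
  ultimately show ?thesis by (auto elim!: eventually_mono)
qed

section \<open>Geometry of a graph boundary\<close>

text \<open>\<open>A\<close> is the part of \<Omega> on one side of the graph, cut off at radius
  \<open>3 * \<rho>\<close>, and \<open>e\<close> is the vertical direction pointing to that side.
  Moving along \<open>e\<close> strictly increases the height over the graph, so closure points of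
  \<open>A\<close> enter \<open>A\<close>; inside the cut-off radius \<open>A\<close> is bounded by
  \<Gamma> alone. \<open>A\<close> and \<open>e\<close> depend on \<open>x\<close>, but \<rho> does
  not.\<close>

lemma graph_boundary_locally:
  fixes \<Omega> :: "(real ^ 'n) set"
  assumes "open \<Omega>" and graph: "locally_continuous_graph (frontier \<Omega>)" and "y \<in> frontier \<Omega>"
  obtains \<rho> where "\<rho> > 0"
    "\<And>x. x \<in> \<Omega> \<Longrightarrow> x \<in> ball y \<rho> \<Longrightarrow> \<exists>A e. open A \<and> x \<in> A \<and> A \<subseteq> \<Omega> \<and> norm e = 1 \<and>
       (\<forall>w s. w \<in> closure A \<longrightarrow> dist y w \<le> 2 * \<rho> \<longrightarrow> 0 < s \<longrightarrow> s < \<rho> \<longrightarrow> w + s *\<^sub>R e \<in> A) \<and>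
       (\<forall>w. w \<in> frontier A \<longrightarrow> dist y w \<le> 2 * \<rho> \<longrightarrow> w \<in> frontier \<Omega>)"
proof -
  obtain W and Q :: "real ^ 'n ^ 'n" and k D \<phi> where W: "open W" "y \<in> W" and Q: "rotation_matrix Q"
    and D: "openin (top_of_set {z. z $ k = 0}) D" and \<phi>: "continuous_on D \<phi>"
    and im: "(\<lambda>x. Q *v x) ` (frontier \<Omega> \<inter> W) = (\<lambda>z. z + \<phi> z *\<^sub>R axis k 1) ` D"
  proof -
    obtain \<W> where \<W>: "\<forall>W\<in>\<W>. open W" "frontier \<Omega> \<subseteq> \<Union>\<W>"
      and *: "\<forall>W\<in>\<W>. \<exists>(Q :: real ^ 'n ^ 'n) k D \<phi>. rotation_matrix Q \<and>
          openin (top_of_set {z. z $ k = 0}) D \<and> continuous_on D \<phi> \<and>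
          (\<lambda>x. Q *v x) ` (frontier \<Omega> \<inter> W) = (\<lambda>z. z + \<phi> z *\<^sub>R axis k 1) ` D"
      using graph unfolding locally_continuous_graph_def by blast
    obtain W where "W \<in> \<W>" "y \<in> W" using \<W>(2) \<open>y \<in> frontier \<Omega>\<close> by blast
    have "open W" using \<W>(1) \<open>W \<in> \<W>\<close> by blast
    from bspec[OF * \<open>W \<in> \<W>\<close>] show ?thesis
      by (elim exE conjE) (rule that[OF \<open>open W\<close> \<open>y \<in> W\<close>])
  qed
  have om: "orthogonal_matrix Q" using Q by (simp add: rotation_matrix_def)
  then have ot: "orthogonal_transformation (\<lambda>x. Q *v x)"
    by (simp add: orthogonal_transformation_matrix)
  have nQ: "norm (Q *v x) = norm x" for x
    using ot by (simp add: orthogonal_transformation_norm)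
  have injQ: "Q *v x = Q *v x' \<Longrightarrow> x = x'" for x x'
    using orthogonal_transformation_inj[OF ot] by (auto dest: injD)
  define e0 where "e0 = transpose Q *v axis k (1::real)"
  have Qe0: "Q *v e0 = axis k 1"
    unfolding e0_def matrix_vector_mul_assoc
    using om by (simp only: orthogonal_matrix_def matrix_vector_mul_lid)
  then have ne0: "norm e0 = 1" using nQ[of e0] by simp
  define H where "H x = (Q *v x) $ k" for x
  define p where "p x = Q *v x - H x *\<^sub>R axis k 1" for x
  have Hs: "H (x + s *\<^sub>R e0) = H x + s" for x s
    by (simp add: H_def matrix_vector_right_distrib matrix_vector_mult_scaleR Qe0)
  have ps: "p (x + s *\<^sub>R e0) = p x" for x s
    unfolding p_def Hs by (simp add: matrix_vector_right_distrib matrix_vector_mult_scaleR Qe0 algebra_simps)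
  have pk: "p x $ k = 0" for x by (simp add: p_def H_def)
  have Qp: "Q *v x = p x + H x *\<^sub>R axis k 1" for x by (simp add: p_def)
  have Dk: "z $ k = 0" if "z \<in> D" for z using D that openin_subset by fastforce
  have G1: "p x \<in> D \<and> H x = \<phi> (p x)" if "x \<in> frontier \<Omega>" "x \<in> W" for x
  proof -
    have "Q *v x \<in> (\<lambda>z. z + \<phi> z *\<^sub>R axis k 1) ` D" using im that by blast
    then obtain z where z: "z \<in> D" "Q *v x = z + \<phi> z *\<^sub>R axis k 1" by auto
    then have "H x = \<phi> z" using Dk[OF z(1)] by (simp add: H_def)
    moreover from this have "p x = z" using z(2) by (simp add: p_def)
    ultimately show ?thesis using z by simp
  qed
  have G2: "x \<in> frontier \<Omega>" if "p x \<in> D" "H x = \<phi> (p x)" for x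
  proof -
    have "Q *v x \<in> (\<lambda>x. Q *v x) ` (frontier \<Omega> \<inter> W)"
      unfolding im using that Qp[of x] by auto
    then show ?thesis using injQ by blast
  qed
  obtain T where T: "open T" "D = {z. z $ k = 0} \<inter> T"
    using D by (auto simp: openin_open)
  have "p y \<in> T" using G1 W T \<open>y \<in> frontier \<Omega>\<close> by auto
  have cp: "continuous_on S p" for S
    unfolding p_def H_def
    by (intro continuous_intros linear_continuous_on matrix_vector_mul_bounded_linear)
  have cH: "continuous_on S H" for S
    unfolding H_def
    by (intro continuous_intros linear_continuous_on matrix_vector_mul_bounded_linear)
  have "open (p -` T)" using cp[of UNIV] \<open>open T\<close> by (simp add: open_vimage)
  then have "open (p -` T \<inter> W)" using W by blast
  moreover have "y \<in> p -` T \<inter> W" using W \<open>p y \<in> T\<close> by simp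
  ultimately obtain r where r: "r > 0" "ball y r \<subseteq> p -` T \<inter> W" using openE by blast
  \<comment> \<open>This is where openness of \<open>D\<close> matters: every point of the ball, not
    only those of \<Gamma>, lies on the vertical line over a point of \<open>D\<close>, so the graph
    separates the ball into points above and below it.\<close>
  have rD: "p x \<in> D" if "x \<in> ball y r" for x using r that T(2) pk by blast
  have rW: "x \<in> W" if "x \<in> ball y r" for x using r that by blast
  \<comment> \<open>Points within \<open>2 * \<rho>\<close> of \<open>y\<close>, moved by less than
    \<rho>, stay in the ball of radius \<open>r\<close>.\<close>
  define \<rho> where "\<rho> = r / 3"
  have "\<rho> > 0" using r by (simp add: \<rho>_def)
  have "\<exists>A e. open A \<and> x \<in> A \<and> A \<subseteq> \<Omega> \<and> norm e = 1 \<and>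
       (\<forall>w s. w \<in> closure A \<longrightarrow> dist y w \<le> 2 * \<rho> \<longrightarrow> 0 < s \<longrightarrow> s < \<rho> \<longrightarrow> w + s *\<^sub>R e \<in> A) \<and>
       (\<forall>w. w \<in> frontier A \<longrightarrow> dist y w \<le> 2 * \<rho> \<longrightarrow> w \<in> frontier \<Omega>)"
    if x: "x \<in> \<Omega>" "x \<in> ball y \<rho>" for x
  proof -
    have xr: "x \<in> ball y r" using x r by (simp add: \<rho>_def)
    have "x \<notin> frontier \<Omega>" using x \<open>open \<Omega>\<close> by (simp add: frontier_def interior_open)
    then have "H x \<noteq> \<phi> (p x)" using G2 rD[OF xr] by blast
    \<comment> \<open>\<open>\<Omega>\<close> is not assumed to lie on one side of the graph only: \<open>A\<close> is the side of \<open>x\<close>.\<close>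
    define \<sigma> where "\<sigma> = sgn (H x - \<phi> (p x))"
    have \<sigma>: "\<sigma> * \<sigma> = 1" "\<bar>\<sigma>\<bar> = 1" "\<sigma> * (H x - \<phi> (p x)) > 0"
      using \<open>H x \<noteq> \<phi> (p x)\<close> by (auto simp: \<sigma>_def sgn_if)
    \<comment> \<open>Signed height over the graph, positive at \<open>x\<close>; it grows with unit
      speed along \<open>e\<close>.\<close>
    define g where "g w = \<sigma> * (H w - \<phi> (p w))" for w
    define e where "e = \<sigma> *\<^sub>R e0"
    define A where "A = \<Omega> \<inter> (ball y r \<inter> g -` {0<..})"
    have cg: "continuous_on (ball y r) g"
      unfolding g_def
      by (intro continuous_intros cH continuous_on_compose2[OF \<phi> cp]) (use rD in auto)
    have gs: "g (w + s *\<^sub>R e) = g w + s" for w s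
      using Hs[of w "s * \<sigma>"] ps[of w "s * \<sigma>"] \<sigma>(1) by (simp add: g_def e_def algebra_simps)
    have "norm e = 1" using ne0 \<sigma> by (simp add: e_def)
    have "open A"
      unfolding A_def using cg \<open>open \<Omega>\<close>
      by (intro open_Int continuous_open_preimage) auto
    have "x \<in> A" using x xr \<sigma> by (simp add: A_def g_def)
    have g_front: "w \<notin> frontier \<Omega>" if "w \<in> ball y r" "g w \<noteq> 0" for w
      using G1[of w] rW[OF that(1)] that by (auto simp: g_def)
    have g_cl: "g w \<ge> 0" if w: "w \<in> closure A" "w \<in> ball y r" for w
    proof (rule ccontr)
      assume "\<not> g w \<ge> 0"
      have "open (ball y r \<inter> g -` {..<0})" using cg by (intro continuous_open_preimage) auto
      moreover have "w \<in> ball y r \<inter> g -` {..<0}" using w \<open>\<not> g w \<ge> 0\<close> by simp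
      moreover have "(ball y r \<inter> g -` {..<0}) \<inter> A = {}" by (auto simp: A_def)
      ultimately show False using w(1) open_Int_closure_eq_empty by blast
    qed
    have frontA: "w \<in> frontier \<Omega>" if w: "w \<in> frontier A" "dist y w \<le> 2 * \<rho>" for w
    proof -
      have wr: "w \<in> ball y r" using w r by (simp add: \<rho>_def)
      have wA: "w \<in> closure A" "w \<notin> A" using w \<open>open A\<close> by (auto simp: frontier_def interior_open)
      have "w \<notin> \<Omega>"
      proof
        assume "w \<in> \<Omega>"
        then have "g w = 0" using wA g_cl[OF wA(1) wr] wr by (auto simp: A_def)
        then have "w \<in> frontier \<Omega>" using G2[OF rD[OF wr]] \<sigma> by (auto simp: g_def)
        then show False using \<open>w \<in> \<Omega>\<close> \<open>open \<Omega>\<close> by (simp add: frontier_def interior_open)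
      qed
      moreover have "w \<in> closure \<Omega>" using wA(1) closure_mono[of A \<Omega>] by (auto simp: A_def)
      ultimately show ?thesis using \<open>open \<Omega>\<close> by (simp add: frontier_def interior_open)
    qed
    \<comment> \<open>A vertical segment leaving \<Omega> would meet \<Gamma> at positive height,
      whereas \<Gamma> has height 0 inside the ball.\<close>
    have step: "a + s *\<^sub>R e \<in> \<Omega>" if a: "a \<in> A" "a + s *\<^sub>R e \<in> ball y r" "s > 0" for a s
    proof (rule ccontr)
      assume "a + s *\<^sub>R e \<notin> \<Omega>"
      then have "closed_segment a (a + s *\<^sub>R e) \<inter> frontier \<Omega> \<noteq> {}"
        using a(1) by (intro connected_Int_frontier) (auto simp: A_def)
      then obtain b where b: "b \<in> closed_segment a (a + s *\<^sub>R e)" "b \<in> frontier \<Omega>" by blast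
      then obtain l where l: "0 \<le> l" "l \<le> 1" "b = (1 - l) *\<^sub>R a + l *\<^sub>R (a + s *\<^sub>R e)"
        by (auto simp: closed_segment_def)
      then have "b = a + (l * s) *\<^sub>R e" by (simp add: algebra_simps)
      then have "g b = g a + l * s" using gs by simp
      then have "g b > 0" using a l by (simp add: A_def add_pos_nonneg)
      moreover have "b \<in> ball y r"
        using b(1) a(1,2) closed_segment_subset[of a "ball y r" "a + s *\<^sub>R e"] convex_ball
        by (auto simp: A_def)
      ultimately show False using g_front[of b] b(2) by auto
    qed
    have shiftA: "w + s *\<^sub>R e \<in> A" if w: "w \<in> closure A" "dist y w \<le> 2 * \<rho>" "0 < s" "s < \<rho>" for w s
    proof -
      have wr: "w \<in> ball y r" using w r by (simp add: \<rho>_def)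
      have "dist y (w + s *\<^sub>R e) \<le> dist y w + s"
        using dist_triangle[of y "w + s *\<^sub>R e" w] \<open>norm e = 1\<close> w by (simp add: dist_norm)
      then have w'r: "w + s *\<^sub>R e \<in> ball y r" using w by (simp add: \<rho>_def)
      have gw': "g (w + s *\<^sub>R e) > 0" using gs g_cl[OF w(1) wr] w by simp
      \<comment> \<open>\<open>w\<close> itself may lie outside \<Omega>, so \<open>step\<close> is
        applied to nearby points of \<open>A\<close>. Positive height excludes \<Gamma>; hence a
        translate outside \<Omega> would have a whole neighbourhood outside, containing translates
        of such points.\<close>
      have "w + s *\<^sub>R e \<in> \<Omega>"
      proof (rule ccontr)
        assume "w + s *\<^sub>R e \<notin> \<Omega>"
        then have "w + s *\<^sub>R e \<notin> closure \<Omega>"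
          using g_front[OF w'r] gw' \<open>open \<Omega>\<close> by (simp add: frontier_def interior_open)
        then have "open (ball y r - closure \<Omega>)" "w + s *\<^sub>R e \<in> ball y r - closure \<Omega>" using w'r by auto
        then obtain \<delta> where \<delta>: "\<delta> > 0" "ball (w + s *\<^sub>R e) \<delta> \<subseteq> ball y r - closure \<Omega>" using openE by blast
        obtain a where a: "a \<in> A" "dist a w < \<delta>" using w(1) \<delta>(1) closure_approachable by blast
        then have "a + s *\<^sub>R e \<in> ball (w + s *\<^sub>R e) \<delta>" by (simp add: dist_norm norm_minus_commute)
        then have "a + s *\<^sub>R e \<in> ball y r - closure \<Omega>" using \<delta>(2) by blast
        then have *: "a + s *\<^sub>R e \<in> ball y r" "a + s *\<^sub>R e \<notin> closure \<Omega>" by blast+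
        then show False using step[OF a(1) *(1) w(3)] closure_subset by blast
      qed
      then show ?thesis using w'r gw' by (simp add: A_def)
    qed
    show ?thesis
      by (rule exI[of _ A], rule exI[of _ e])
         (use \<open>open A\<close> \<open>x \<in> A\<close> \<open>norm e = 1\<close> shiftA frontA in \<open>auto simp: A_def\<close>)
  qed
  then show ?thesis using that[OF \<open>\<rho> > 0\<close>] by blast
qed

section \<open>Comparison near the boundary\<close>

lemma filterlim_translate_within:
  fixes y a :: "'a::real_normed_vector"
  assumes "\<And>x. x \<in> P \<Longrightarrow> x + a \<in> R"
  shows "filterlim (\<lambda>p. (fst p + a, snd p)) (at (y + a, s) within R \<times> T) (at (y, s) within P \<times> T)"
proof -
  have "((\<lambda>p. (fst p + a, snd p)) \<longlongrightarrow> (y + a, s)) (at (y, s) within P \<times> T)"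
    by (auto intro!: tendsto_eq_intros)
  moreover have "\<forall>\<^sub>F p in at (y, s) within P \<times> T. (fst p + a, snd p) \<in> R \<times> T \<and> (fst p + a, snd p) \<noteq> (y + a, s)"
    unfolding eventually_at_filter using assms by (intro always_eventually) (auto simp: prod_eq_iff)
  ultimately show ?thesis by (simp add: filterlim_at)
qed

lemma positive_large_solution_eventually_gt:
  assumes "positive_large_solution q \<Omega> f u" "y \<in> frontier \<Omega>" "s > 0" "P \<subseteq> \<Omega>"
  shows "\<forall>\<^sub>F p in at (y, s) within P \<times> {0<..}. K < u (fst p) (snd p)"
proof -
  have "filterlim (\<lambda>(x, t). u x t) at_top (at (y, s) within \<Omega> \<times> {0<..})"
    using assms by (auto simp: positive_large_solution_def)
  then have "\<forall>\<^sub>F p in at (y, s) within \<Omega> \<times> {0<..}. K < u (fst p) (snd p)"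
    by (auto simp: filterlim_at_top_dense case_prod_beta')
  then show ?thesis
    by (rule filter_leD[rotated]) (use \<open>P \<subseteq> \<Omega>\<close> in \<open>auto intro!: at_le\<close>)
qed

text \<open>A translate of \<open>n * (v - u - B)\<close> is compared with the untranslated
  \<open>u\<close>. On \<Gamma>, where \<open>u\<close> is infinite, the translate takes its values
  inside \<Omega> and is bounded above; where the translated point reaches the sphere,
  \<open>B\<close> is infinite; at \<open>t = 0\<close>, \<open>difference_small_initially\<close>
  applies at the translated point.\<close>

lemma difference_le_barrier:
  fixes \<Omega> :: "(real ^ 'n) set"
  assumes q: "q > 1" and "open \<Omega>"
    and u: "positive_large_solution q \<Omega> f u" and v: "positive_large_solution q \<Omega> f v"
    and A: "open A" "A \<subseteq> \<Omega>" "norm e = 1"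
      "\<And>w s. w \<in> closure A \<Longrightarrow> dist y w \<le> 2 * \<rho> \<Longrightarrow> 0 < s \<Longrightarrow> s < \<rho> \<Longrightarrow> w + s *\<^sub>R e \<in> A"
      "\<And>w. w \<in> frontier A \<Longrightarrow> dist y w \<le> 2 * \<rho> \<Longrightarrow> w \<in> frontier \<Omega>"
    and B: "heat_on (ball y \<rho>) B M"
      "\<And>x t. x \<in> ball y \<rho> \<Longrightarrow> t > 0 \<Longrightarrow> B x t > 0"
      "\<And>x t. x \<in> ball y \<rho> \<Longrightarrow> t > 0 \<Longrightarrow> M x t + B x t powr q \<ge> 0"
      "\<And>K \<tau>. \<tau> > 0 \<Longrightarrow> \<exists>r<\<rho>. \<forall>x\<in>ball y \<rho>. \<forall>t\<ge>\<tau>. r < dist y x \<longrightarrow> K < B x t"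
    and x: "x \<in> A" "x \<in> ball y \<rho>" and "t > 0"
  shows "v x t - u x t \<le> B x t"
proof -
  have pos: "u x t > 0" "v x t > 0" if "x \<in> \<Omega>" "t > 0" for x t
    using u v that by (auto simp: positive_large_solution_def)
  note hu = positive_large_solution_heat_on[OF u] and hv = positive_large_solution_heat_on[OF v]
  have "\<rho> > 0" using x by (metis ball_eq_empty empty_iff not_le)
  define Y where "Y x t = v x t - u x t - B x t" for x t
  have hY: "heat_on (A \<inter> ball y \<rho>) Y (\<lambda>x t. - (v x t powr q) - - (u x t powr q) - M x t)"
    unfolding Y_def
    by (intro heat_on_diff heat_on_subset[OF hu] heat_on_subset[OF hv] heat_on_subset[OF B(1)])
       (use A in auto)
  have mult: "real n * Y x t \<le> u x t" if "x \<in> A" "x \<in> ball y \<rho>" "t > 0" for n x t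
    using that
  proof (induction n arbitrary: x t)
    case 0
    then show ?case using pos[of x t] A by auto
  next
    case (Suc n)
    define m where "m = real n + 1"
    have "m > 0" by (simp add: m_def)
    have claim: "m * Y (w + s *\<^sub>R e) t \<le> u w t"
      if s: "0 < s" "s < \<rho>" and w: "w \<in> A" "w + s *\<^sub>R e \<in> ball y \<rho>" for w s
    proof (rule field_le_epsilon)
      fix \<gamma> :: real assume "\<gamma> > 0"
      \<comment> \<open>The points of \<open>A\<close> whose translates lie in the ball. By
        \<open>Pcl\<close> even the closure of \<open>P\<close> is translated into \<open>A\<close>,
        away from \<Gamma>; this is the purpose of the direction \<open>e\<close>.\<close>
      define P where "P = A \<inter> (\<lambda>x. x + s *\<^sub>R e) -` ball y \<rho>"
      have Pcl: "z + s *\<^sub>R e \<in> A" "dist y (z + s *\<^sub>R e) \<le> \<rho>" "z \<in> closure A" "dist y z \<le> 2 * \<rho>"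
        if "z \<in> closure P" for z
      proof -
        have "closed ((\<lambda>x. x + s *\<^sub>R e) -` cball y \<rho>)"
          by (intro closed_vimage continuous_intros) auto
        moreover have "P \<subseteq> (\<lambda>x. x + s *\<^sub>R e) -` cball y \<rho>" by (auto simp: P_def)
        ultimately have "z \<in> (\<lambda>x. x + s *\<^sub>R e) -` cball y \<rho>" using that closure_minimal by blast
        then show 1: "dist y (z + s *\<^sub>R e) \<le> \<rho>" by simp
        show 2: "z \<in> closure A" using that closure_mono[of P A] by (auto simp: P_def)
        show 3: "dist y z \<le> 2 * \<rho>"
          using dist_triangle[of y z "z + s *\<^sub>R e"] 1 s \<open>norm e = 1\<close> by (simp add: dist_norm)
        show "z + s *\<^sub>R e \<in> A" using A(4)[OF 2 3] s by simp
      qed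
      have PA: "z + s *\<^sub>R e \<in> A \<inter> ball y \<rho>" "z \<in> A" if "z \<in> P" for z
        using Pcl(1)[of z] that closure_subset[of P] by (auto simp: P_def)
      have "m * Y (w + s *\<^sub>R e) t - u w t < \<gamma>"
      proof (rule parabolic_maximum_principle[where P=P and T=t and w="\<lambda>x t. m * Y (x + s *\<^sub>R e) t - u x t"])
        show "open P" unfolding P_def
          using A(1) by (intro open_Int open_vimage continuous_intros) auto
        have "P \<subseteq> cball y (2 * \<rho>)" using Pcl(4) closure_subset[of P] by auto
        then show "bounded P" using bounded_cball bounded_subset by blast
        show "heat_on P (\<lambda>x t. m * Y (x + s *\<^sub>R e) t - u x t)
          (\<lambda>x t. m * (- (v (x + s *\<^sub>R e) t powr q) - - (u (x + s *\<^sub>R e) t powr q) - M (x + s *\<^sub>R e) t) - - (u x t powr q))"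
          by (rule heat_on_diff[OF heat_on_cmult[OF heat_on_translate[OF hY]] heat_on_subset[OF hu]])
             (use PA A in auto)
        show "m * (- (v (z + s *\<^sub>R e) \<tau> powr q) - - (u (z + s *\<^sub>R e) \<tau> powr q) - M (z + s *\<^sub>R e) \<tau>)
            - - (u z \<tau> powr q) < 0"
          if z: "z \<in> P" "0 < \<tau>" "\<tau> \<le> t" "\<gamma> \<le> m * Y (z + s *\<^sub>R e) \<tau> - u z \<tau>" for z \<tau>
        proof -
          define z' where "z' = z + s *\<^sub>R e"
          have z': "z' \<in> A" "z' \<in> ball y \<rho>" using PA[OF z(1)] by (auto simp: z'_def)
          have uz: "u z \<tau> > 0" "u z' \<tau> > 0" using pos PA[OF z(1)] z' A z by auto
          have big: "u z \<tau> < m * Y z' \<tau>" using z(4) \<open>\<gamma> > 0\<close> by (simp add: z'_def)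
          then have "Y z' \<tau> > 0" using uz \<open>m > 0\<close> by (smt (verit) zero_less_mult_pos)
          \<comment> \<open>The induction hypothesis is used at the translated point, where the
            equation for \<open>Y\<close> holds; \<open>big\<close> then links the result to
            \<open>u\<close> at the untranslated point.\<close>
          have "(m * Y z' \<tau>) powr q \<le> m * ((u z' \<tau> + Y z' \<tau> + B z' \<tau>) powr q - u z' \<tau> powr q - B z' \<tau> powr q)"
            using Suc.IH[OF z' z(2)] \<open>Y z' \<tau> > 0\<close> uz q B(2)[OF z'(2) z(2)]
            by (intro powr_multiple_increment) (auto simp: m_def)
          also have "u z' \<tau> + Y z' \<tau> + B z' \<tau> = v z' \<tau>" by (simp add: Y_def)
          also have "m * (v z' \<tau> powr q - u z' \<tau> powr q - B z' \<tau> powr q)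
              \<le> m * (v z' \<tau> powr q - u z' \<tau> powr q + M z' \<tau>)"
            using B(3)[OF z'(2) z(2)] \<open>m > 0\<close> by (intro mult_left_mono) auto
          finally have "(m * Y z' \<tau>) powr q \<le> m * (v z' \<tau> powr q - u z' \<tau> powr q + M z' \<tau>)" .
          moreover have "u z \<tau> powr q < (m * Y z' \<tau>) powr q"
            using big uz q by (intro powr_less_mono2) auto
          ultimately show ?thesis by (simp add: z'_def algebra_simps)
        qed
        show "\<forall>\<^sub>F p in at (z, \<tau>) within P \<times> {0<..}.
            m * Y (fst p + s *\<^sub>R e) (snd p) - u (fst p) (snd p) < \<gamma>"
          if z: "z \<in> closure P" "0 \<le> \<tau>" "\<tau> \<le> t" "z \<notin> P \<or> \<tau> = 0" for z \<tau>
        proof -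
          let ?F = "at (z, \<tau>) within P \<times> {0<..}"
          define z' where "z' = z + s *\<^sub>R e"
          have z': "z' \<in> A" "dist y z' \<le> \<rho>" using Pcl[OF z(1)] by (auto simp: z'_def)
          then have z'\<Omega>: "z' \<in> \<Omega>" using A by auto
          have tr: "filterlim (\<lambda>p. (fst p + s *\<^sub>R e, snd p)) (at (z', \<tau>) within \<Omega> \<times> {0<..}) ?F"
            unfolding z'_def by (rule filterlim_translate_within) (use PA A in auto)
          have inP: "\<forall>\<^sub>F p in ?F. fst p \<in> P \<and> fst p \<in> UNIV \<and> snd p > 0 \<and> snd p \<in> UNIV"
            by (rule eventually_at_within_spacetime) auto
          have Yle: "m * Y (fst p + s *\<^sub>R e) (snd p) \<le>
              m * (v (fst p + s *\<^sub>R e) (snd p) - u (fst p + s *\<^sub>R e) (snd p))" "u (fst p) (snd p) > 0"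
            if "fst p \<in> P" "snd p > 0" for p
            using B(2)[of "fst p + s *\<^sub>R e" "snd p"] PA[OF that(1)] that \<open>m > 0\<close> pos(1)[of "fst p" "snd p"] A(2)
            by (auto simp: Y_def)
          show ?thesis
          proof (cases "\<tau> = 0")
            case True
            have "\<forall>\<^sub>F p in at (z', \<tau>) within \<Omega> \<times> {0<..}. v (fst p) (snd p) - u (fst p) (snd p) < \<gamma> / m"
              using difference_small_initially[OF q \<open>open \<Omega>\<close> z'\<Omega> _ u v] True \<open>\<gamma> > 0\<close> \<open>m > 0\<close> by simp
            from eventually_compose_filterlim[OF this tr] inP
            show ?thesis
            proof eventually_elim
              case (elim p)
              then have "m * (v (fst p + s *\<^sub>R e) (snd p) - u (fst p + s *\<^sub>R e) (snd p)) < \<gamma>"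
                using \<open>m > 0\<close> by (simp add: field_simps)
              then show ?case using Yle[of p] elim by simp
            qed
          next
            case False
            then have \<tau>: "\<tau> > 0" "z \<notin> P" using z by auto
            \<comment> \<open>\<open>z'\<close> lies inside \<Omega>, so \<open>v - u\<close> stays
              below \<open>Z\<close> near it; against this bound either \<open>B\<close> (on the
              sphere) or \<open>u\<close> (on \<Gamma>) wins.\<close>
            define Z where "Z = v z' \<tau> - u z' \<tau> + 1"
            have "((\<lambda>p. v (fst p) (snd p) - u (fst p) (snd p)) \<longlongrightarrow> v z' \<tau> - u z' \<tau>)
                (at (z', \<tau>) within \<Omega> \<times> {0<..})"
              by (rule tendsto_mono[OF _ heat_on_tendsto[OF heat_on_diff[OF hv hu] \<open>open \<Omega>\<close> z'\<Omega> \<tau>(1)]])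
                 (simp add: at_within_def)
            then have "\<forall>\<^sub>F p in at (z', \<tau>) within \<Omega> \<times> {0<..}. v (fst p) (snd p) - u (fst p) (snd p) < Z"
              by (rule order_tendstoD(2)) (simp add: Z_def)
            from eventually_compose_filterlim[OF this tr]
            have evZ: "\<forall>\<^sub>F p in ?F. v (fst p + s *\<^sub>R e) (snd p) - u (fst p + s *\<^sub>R e) (snd p) < Z" by simp
            show ?thesis
            proof (cases "z \<in> A")
              case True
              then have "dist y z' = \<rho>" using \<tau>(2) z' by (auto simp: P_def z'_def)
              obtain r where r: "r < \<rho>" "\<And>x t. x \<in> ball y \<rho> \<Longrightarrow> t \<ge> \<tau> / 2 \<Longrightarrow> r < dist y x \<Longrightarrow> Z < B x t"
                using B(4)[of "\<tau> / 2" Z] \<tau> by auto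
              have "\<forall>\<^sub>F p in ?F. fst p \<in> P \<and> fst p \<in> (\<lambda>x. x + s *\<^sub>R e) -` (- cball y r) \<and> snd p > 0 \<and> snd p \<in> {\<tau> / 2<..}"
                using r \<open>dist y z' = \<rho>\<close> \<tau>(1)
                by (intro eventually_at_within_spacetime open_vimage continuous_intros) (auto simp: z'_def)
              with evZ show ?thesis
              proof eventually_elim
                case (elim p)
                then have "Z < B (fst p + s *\<^sub>R e) (snd p)"
                  using r(2)[of "fst p + s *\<^sub>R e" "snd p"] PA[of "fst p"] by auto
                then have "Y (fst p + s *\<^sub>R e) (snd p) < 0" using elim by (simp add: Y_def)
                then have "m * Y (fst p + s *\<^sub>R e) (snd p) < 0" using \<open>m > 0\<close> by (simp add: mult_pos_neg)
                then show ?case using Yle(2)[of p] elim \<open>\<gamma> > 0\<close> by simp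
              qed
            next
              case False
              then have "z \<in> frontier A" using Pcl(3)[OF z(1)] A(1) by (simp add: frontier_def interior_open)
              then have "z \<in> frontier \<Omega>" using A(5) Pcl(4)[OF z(1)] by blast
              then have "\<forall>\<^sub>F p in ?F. m * Z < u (fst p) (snd p)"
                using positive_large_solution_eventually_gt[OF u _ \<tau>(1), of z P] A by (auto simp: P_def)
              with evZ inP show ?thesis
              proof eventually_elim
                case (elim p)
                have "m * (v (fst p + s *\<^sub>R e) (snd p) - u (fst p + s *\<^sub>R e) (snd p)) < m * Z"
                  using elim \<open>m > 0\<close> by (intro mult_strict_left_mono) auto
                then show ?case using Yle[of p] elim \<open>\<gamma> > 0\<close> by simp
              qed
            qed
          qed
        qed
      qed (use w \<open>t > 0\<close> Suc.prems in \<open>auto simp: P_def\<close>)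
      then show "m * Y (w + s *\<^sub>R e) t \<le> u w t + \<gamma>" by simp
    qed
    \<comment> \<open>\<open>claim\<close> is applied at \<open>w = x - s *\<^sub>R e\<close>, so
      that the translated point stays at \<open>x\<close> and only the argument of \<open>u\<close>
      moves.\<close>
    have "((\<lambda>s. x - s *\<^sub>R e) \<longlongrightarrow> x) (at_right 0)" by (auto intro!: tendsto_eq_intros)
    then have "\<forall>\<^sub>F s in at_right 0. x - s *\<^sub>R e \<in> A"
      using A(1) Suc.prems(1) by (rule topological_tendstoD)
    moreover have "\<forall>\<^sub>F s in at_right 0. s \<in> {0<..<\<rho>}"
      using \<open>\<rho> > 0\<close> by (rule eventually_at_right_real)
    ultimately have "\<forall>\<^sub>F s in at_right 0. m * Y x t \<le> u (x - s *\<^sub>R e) t"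
    proof eventually_elim
      case (elim s)
      then show ?case using claim[of s "x - s *\<^sub>R e"] Suc.prems by simp
    qed
    moreover have "((\<lambda>s. u (x - s *\<^sub>R e) t) \<longlongrightarrow> u x t) (at_right 0)"
    proof -
      have "((\<lambda>s. (x - s *\<^sub>R e, t)) \<longlongrightarrow> (x, t)) (at_right 0)" by (auto intro!: tendsto_eq_intros)
      moreover have "x \<in> \<Omega>" using Suc.prems A by auto
      ultimately show ?thesis
        using filterlim_compose[OF heat_on_tendsto[OF hu \<open>open \<Omega>\<close> _ Suc.prems(3)]] by fastforce
    qed
    ultimately have "m * Y x t \<le> u x t" by (intro tendsto_lowerbound) auto
    then show ?case by (simp add: m_def add.commute)
  qed
  have "Y x t \<le> 0"
  proof (rule ccontr)
    assume "\<not> Y x t \<le> 0"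
    then obtain n where "u x t < real n * Y x t" using reals_Archimedean3[of "Y x t"] by auto
    then show False using mult[OF x \<open>t > 0\<close>, of n] by simp
  qed
  then show ?thesis by (simp add: Y_def)
qed

section \<open>Global comparison\<close>

text \<open>Near \<Gamma> the local estimate gives only \<open>v - u \<le> C * t\<close>, which is
  not small at positive times; the extra \<open>\<epsilon> * u\<close> tends to infinity there and
  absorbs it. At points of \<Gamma> with \<open>t = 0\<close>, where \<open>u\<close> need not blow
  up, \<open>C * t\<close> itself tends to 0. The multiple of \<open>u\<close> is a supersolution
  because \<open>1 + \<epsilon> \<le> (1 + \<epsilon>) powr q\<close>.\<close>

lemma positive_large_solution_le:
  fixes \<Omega> :: "(real ^ 'n) set"
  assumes q: "q > 1" and "open \<Omega>" "bounded \<Omega>" "locally_continuous_graph (frontier \<Omega>)"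
    and u: "positive_large_solution q \<Omega> f u" and v: "positive_large_solution q \<Omega> f v"
    and x: "x \<in> \<Omega>" "t > 0"
  shows "v x t \<le> u x t"
proof -
  have pos: "u x t > 0" "v x t > 0" if "x \<in> \<Omega>" "t > 0" for x t
    using u v that by (auto simp: positive_large_solution_def)
  note hu = positive_large_solution_heat_on[OF u] and hv = positive_large_solution_heat_on[OF v]
  have main: "v x t - (1 + \<epsilon>) * u x t < \<gamma>" if "\<epsilon> > 0" "\<gamma> > 0" for \<epsilon> \<gamma>
  proof (rule parabolic_maximum_principle[where P=\<Omega> and T=t and w="\<lambda>x t. v x t - (1 + \<epsilon>) * u x t"])
    show "heat_on \<Omega> (\<lambda>x t. v x t - (1 + \<epsilon>) * u x t) (\<lambda>x t. - (v x t powr q) - (1 + \<epsilon>) * (- (u x t powr q)))"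
      by (intro heat_on_diff heat_on_cmult hu hv)
    show "- (v z \<tau> powr q) - (1 + \<epsilon>) * (- (u z \<tau> powr q)) < 0"
      if z: "z \<in> \<Omega>" "0 < \<tau>" "\<tau> \<le> t" "\<gamma> \<le> v z \<tau> - (1 + \<epsilon>) * u z \<tau>" for z \<tau>
    proof -
      have "(1 + \<epsilon>) powr 1 \<le> (1 + \<epsilon>) powr q" using q \<open>\<epsilon> > 0\<close> by (intro powr_mono) auto
      then have "(1 + \<epsilon>) * u z \<tau> powr q \<le> (1 + \<epsilon>) powr q * u z \<tau> powr q"
        using \<open>\<epsilon> > 0\<close> by (intro mult_right_mono) auto
      also have "\<dots> = ((1 + \<epsilon>) * u z \<tau>) powr q"
        using \<open>\<epsilon> > 0\<close> pos(1)[OF z(1,2)] by (simp add: powr_mult)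
      also have "\<dots> < v z \<tau> powr q"
        using z(4) \<open>\<epsilon> > 0\<close> \<open>\<gamma> > 0\<close> pos(1)[OF z(1,2)] q by (intro powr_less_mono2) auto
      finally show ?thesis by simp
    qed
    show "\<forall>\<^sub>F p in at (y, s) within \<Omega> \<times> {0<..}. v (fst p) (snd p) - (1 + \<epsilon>) * u (fst p) (snd p) < \<gamma>"
      if y: "y \<in> closure \<Omega>" "0 \<le> s" "s \<le> t" "y \<notin> \<Omega> \<or> s = 0" for y s
    proof (cases "y \<in> \<Omega>")
      case True
      then have "s = 0" using y by simp
      have "\<forall>\<^sub>F p in at (y, s) within \<Omega> \<times> {0<..}. v (fst p) (snd p) - u (fst p) (snd p) < \<gamma>"
        using difference_small_initially[OF q \<open>open \<Omega>\<close> True \<open>\<gamma> > 0\<close> u v] \<open>s = 0\<close> by simp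
      moreover have "\<forall>\<^sub>F p in at (y, s) within \<Omega> \<times> {0<..}. fst p \<in> \<Omega> \<and> fst p \<in> UNIV \<and> snd p > 0 \<and> snd p \<in> UNIV"
        by (rule eventually_at_within_spacetime) auto
      ultimately show ?thesis
      proof eventually_elim
        case (elim p)
        have "0 < \<epsilon> * u (fst p) (snd p)" using pos(1)[of "fst p" "snd p"] elim \<open>\<epsilon> > 0\<close> by simp
        then show ?case using elim by (simp add: algebra_simps)
      qed
    next
      case False
      then have "y \<in> frontier \<Omega>" using y(1) \<open>open \<Omega>\<close> by (simp add: frontier_def interior_open)
      obtain \<rho> where \<rho>: "\<rho> > 0"
        "\<And>x. x \<in> \<Omega> \<Longrightarrow> x \<in> ball y \<rho> \<Longrightarrow> \<exists>A e. open A \<and> x \<in> A \<and> A \<subseteq> \<Omega> \<and> norm e = 1 \<and>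
           (\<forall>w s. w \<in> closure A \<longrightarrow> dist y w \<le> 2 * \<rho> \<longrightarrow> 0 < s \<longrightarrow> s < \<rho> \<longrightarrow> w + s *\<^sub>R e \<in> A) \<and>
           (\<forall>w. w \<in> frontier A \<longrightarrow> dist y w \<le> 2 * \<rho> \<longrightarrow> w \<in> frontier \<Omega>)"
        by (rule graph_boundary_locally[OF \<open>open \<Omega>\<close> assms(4) \<open>y \<in> frontier \<Omega>\<close>]) blast
      obtain B M C where B: "heat_on (ball y \<rho>) B M"
        "\<And>x t. x \<in> ball y \<rho> \<Longrightarrow> t > 0 \<Longrightarrow> B x t > 0"
        "\<And>x t. x \<in> ball y \<rho> \<Longrightarrow> t > 0 \<Longrightarrow> M x t + B x t powr q \<ge> 0"
        "\<And>K \<tau>. \<tau> > 0 \<Longrightarrow> \<exists>r<\<rho>. \<forall>x\<in>ball y \<rho>. \<forall>t\<ge>\<tau>. r < dist y x \<longrightarrow> K < B x t"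
        "\<And>x t. x \<in> ball y (\<rho> / 2) \<Longrightarrow> t > 0 \<Longrightarrow> B x t \<le> C * t" "C > 0"
        by (rule barrier_exists[OF q \<open>\<rho> > 0\<close>, of y]) blast
      \<comment> \<open>\<open>A\<close> and \<open>e\<close> vary with \<open>z\<close>, but \<rho>
        and the barrier are fixed by \<open>y\<close>, so \<open>C\<close> is uniform in
        \<open>z\<close>.\<close>
      have le: "v z \<tau> - u z \<tau> \<le> C * \<tau>" if z: "z \<in> \<Omega>" "z \<in> ball y (\<rho> / 2)" "\<tau> > 0" for z \<tau>
      proof -
        have zr: "z \<in> ball y \<rho>" using z \<rho> by auto
        obtain A e where "open A" "z \<in> A" "A \<subseteq> \<Omega>" "norm e = 1"
          "\<And>w s. w \<in> closure A \<Longrightarrow> dist y w \<le> 2 * \<rho> \<Longrightarrow> 0 < s \<Longrightarrow> s < \<rho> \<Longrightarrow> w + s *\<^sub>R e \<in> A"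
          "\<And>w. w \<in> frontier A \<Longrightarrow> dist y w \<le> 2 * \<rho> \<Longrightarrow> w \<in> frontier \<Omega>"
          using \<rho>(2)[OF z(1) zr] by blast
        then have "v z \<tau> - u z \<tau> \<le> B z \<tau>"
          using difference_le_barrier[OF q \<open>open \<Omega>\<close> u v _ _ _ _ _ B(1-4)] zr z(3) by blast
        also have "\<dots> \<le> C * \<tau>" using B(5) z by blast
        finally show ?thesis .
      qed
      show ?thesis
      proof (cases "s = 0")
        case True
        have "\<forall>\<^sub>F p in at (y, s) within \<Omega> \<times> {0<..}. fst p \<in> \<Omega> \<and> fst p \<in> ball y (\<rho> / 2) \<and> snd p > 0 \<and> snd p \<in> {..<\<gamma> / C}"
          by (rule eventually_at_within_spacetime) (use True \<rho> B \<open>\<gamma> > 0\<close> in auto)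
        then show ?thesis
        proof eventually_elim
          case (elim p)
          have "0 < \<epsilon> * u (fst p) (snd p)" using pos(1)[of "fst p" "snd p"] elim \<open>\<epsilon> > 0\<close> by simp
          moreover have "C * snd p < \<gamma>" using elim \<open>C > 0\<close> by (simp add: field_simps)
          ultimately show ?case using le[of "fst p" "snd p"] elim by (simp add: algebra_simps)
        qed
      next
        case False
        then have "s > 0" using y by simp
        have "\<forall>\<^sub>F p in at (y, s) within \<Omega> \<times> {0<..}. fst p \<in> \<Omega> \<and> fst p \<in> ball y (\<rho> / 2) \<and> snd p > 0 \<and> snd p \<in> {..<s + 1}"
          by (rule eventually_at_within_spacetime) (use \<rho> in auto)
        moreover have "\<forall>\<^sub>F p in at (y, s) within \<Omega> \<times> {0<..}. C * (s + 1) / \<epsilon> < u (fst p) (snd p)"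
          by (rule positive_large_solution_eventually_gt[OF u \<open>y \<in> frontier \<Omega>\<close> \<open>s > 0\<close>]) simp
        ultimately show ?thesis
        proof eventually_elim
          case (elim p)
          have "C * snd p \<le> C * (s + 1)" using elim \<open>C > 0\<close> by (intro mult_left_mono) auto
          moreover have "C * (s + 1) < \<epsilon> * u (fst p) (snd p)"
            using elim \<open>\<epsilon> > 0\<close> by (simp add: field_simps)
          ultimately show ?case using le[of "fst p" "snd p"] elim \<open>\<gamma> > 0\<close> by (simp add: algebra_simps)
        qed
      qed
    qed
  qed (use assms in auto)
  show ?thesis
  proof (rule field_le_epsilon)
    fix d :: real assume "d > 0"
    have "u x t > 0" using pos x by blast
    \<comment> \<open>This choice makes \<open>\<epsilon> * u x t\<close> and the tolerance \<gamma>
      equal to \<open>d / 2\<close> each.\<close>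
    have "v x t - (1 + d / (2 * u x t)) * u x t < d / 2"
      by (rule main) (use \<open>d > 0\<close> \<open>u x t > 0\<close> in auto)
    then show "v x t \<le> u x t + d" using \<open>u x t > 0\<close> by (simp add: algebra_simps)
  qed
qed

theorem theoremB:
  fixes q :: real
    and \<Omega> :: "(real ^ 'n) set"
    and f :: "real ^ 'n \<Rightarrow> real"
    and u v :: "real ^ 'n \<Rightarrow> real \<Rightarrow> real"
  assumes "q > 1"
    and "open \<Omega>" and "connected \<Omega>" and "\<Omega> \<noteq> {}" and "bounded \<Omega>"
    and "locally_continuous_graph (frontier \<Omega>)"
    and "L1_loc \<Omega> f"
    and "AE x in lebesgue. x \<in> \<Omega> \<longrightarrow> f x \<ge> 0"
    and "positive_large_solution q \<Omega> f u"
    and "positive_large_solution q \<Omega> f v"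
  shows "\<forall>x\<in>\<Omega>. \<forall>t>0. u x t = v x t"
proof (intro ballI allI impI antisym)
  fix x t assume "x \<in> \<Omega>" "(t::real) > 0"
  then show "u x t \<le> v x t" "v x t \<le> u x t"
    using positive_large_solution_le[OF assms(1,2,5,6) assms(10,9)]
      positive_large_solution_le[OF assms(1,2,5,6) assms(9,10)] by auto
qed

end
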